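(* The function $[0,1]\ni p\mapsto v_p$ is continuous at $p_c$, where $v_p$ is the almost sure constant value of the game on $\mathbb L$ with i.i.d. Bernoulli($p$) edge costs and $p_c$ is the critical parameter of oriented percolation on $\mathbb L$.
   Context: Graph. $\mathbb L=\{(x,y)\in\mathbb Z^2: x+y \text{ is even}\}$, with an edge between two points exactly when they are at Euclidean distance $\sqrt2$. $E$ is the set of (non-oriented) edges. Each edge $e$ carries a cost $c(e)$; the $(c(e))_{e\in E}$ are i.i.d. Bernoulli random variables with parameter $p\in[0,1]$; the law is $\mathbb P_p$. An edge is open if its cost is $1$ and closed if its cost is $0$. Oriented percolation. A path is a (finite, semi-infinite or bi-infinite) sequence of vertices of $\mathbb L$ such that consecutive vertices are joined by an edge; it is vertical if the second coordinate is monotone along the path; it is open if all its edges are open; an infinite path is one indexed by all of $\mathbb Z$. The critical parameter $p_c\in(0,1)$ is the unique number such that for $p<p_c$, $\mathbb P_p$-almost surely there is no infinite vertical open path, and for $p>p_c$, $\mathbb P_p$-almost surely there is an infinite vertical open path. Game. For a fixed realization of $(c(e))_{e\in E}$ (known to both players from the start) and $z\in\mathbb L$, the zero-sum game $\Gamma(z)$ is as follows. A token is placed at $z$. At each stage $m\ge1$, Player 1 selects an action in $\{T,B\}$ and announces it; then Player 2 selects an action in $\{L,R\}$. If the token is at $(x,y)$, it moves to $(x+1,y+1)$ if $(T,R)$ is played, to $(x-1,y+1)$ if $(T,L)$, to $(x+1,y-1)$ if $(B,R)$, to $(x-1,y-1)$ if $(B,L)$. Let $e_m$ be the edge crossed at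 stage $m$. The history at stage $m$ is $(e_1,\dots,e_{m-1})$, and $H=\bigcup_{m\ge1}E^{m-1}$. A strategy of Player 1 is a map $\sigma:H\to\{T,B\}$; a strategy of Player 2 is a map $\tau:H\to\{L,R\}^2$, whose first (resp. second) component is the action played when Player 1 plays $T$ (resp. $B$) at that stage. The sets of strategies are $\Sigma$ and $\mathcal T$. Player 1 minimizes and Player 2 maximizes the total cost $\gamma(z,\sigma,\tau)=\limsup_{n\to+\infty}\frac1n\sum_{m=1}^n c(e_m)$. The game has a value $v(z)=\inf_{\sigma\in\Sigma}\sup_{\tau\in\mathcal T}\gamma(z,\sigma,\tau)=\sup_{\tau\in\mathcal T}\inf_{\sigma\in\Sigma}\gamma(z,\sigma,\tau)$. For each $p$ there is a constant $v_p\in[0,1]$ such that $\mathbb P_p$-almost surely $v(z)=v_p$ for all $z\in\mathbb L$; this defines $v_p$. *)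

theory Defs
  imports "HOL-Probability.Probability"
begin

section \<open>The graph and its random edge costs\<close>

type_synonym vertex = "int \<times> int"
type_synonym edge = "vertex set"

definition LL :: "vertex set" where
  "LL = {(x, y). even (x + y)}"

definition adjacent :: "vertex \<Rightarrow> vertex \<Rightarrow> bool" where
  "adjacent u w \<longleftrightarrow> u \<in> LL \<and> w \<in> LL \<and>
     dist (real_of_int (fst u), real_of_int (snd u)) (real_of_int (fst w), real_of_int (snd w)) = sqrt 2"

definition EE :: "edge set" where
  "EE = {{u, w} |u w. adjacent u w}"

text \<open>A configuration \<open>c\<close> assigns \<open>True\<close> to the open edges (cost 1) and \<open>False\<close> to the closed
  edges (cost 0).\<close>

type_synonym config = "edge \<Rightarrow> bool"

definition cost :: "config \<Rightarrow> edge \<Rightarrow> real" where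
  "cost c e = of_bool (c e)"

definition config_measure :: "real \<Rightarrow> config measure" where
  "config_measure p = PiM EE (\<lambda>_. measure_pmf (bernoulli_pmf p))"

section \<open>Oriented percolation\<close>

definition infinite_path :: "(int \<Rightarrow> vertex) \<Rightarrow> bool" where
  "infinite_path \<pi> \<longleftrightarrow> (\<forall>i. adjacent (\<pi> i) (\<pi> (i + 1)))"

definition vertical :: "(int \<Rightarrow> vertex) \<Rightarrow> bool" where
  "vertical \<pi> \<longleftrightarrow> mono (\<lambda>i. snd (\<pi> i)) \<or> antimono (\<lambda>i. snd (\<pi> i))"

definition open_path :: "config \<Rightarrow> (int \<Rightarrow> vertex) \<Rightarrow> bool" where
  "open_path c \<pi> \<longleftrightarrow> (\<forall>i. cost c {\<pi> i, \<pi> (i + 1)} = 1)"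

definition has_infinite_vertical_open_path :: "config \<Rightarrow> bool" where
  "has_infinite_vertical_open_path c \<longleftrightarrow> (\<exists>\<pi>. infinite_path \<pi> \<and> vertical \<pi> \<and> open_path c \<pi>)"

definition is_critical_parameter :: "real \<Rightarrow> bool" where
  "is_critical_parameter pc \<longleftrightarrow> 0 < pc \<and> pc < 1 \<and>
     (\<forall>p\<in>{0..1}. p < pc \<longrightarrow> (AE c in config_measure p. \<not> has_infinite_vertical_open_path c)) \<and>
     (\<forall>p\<in>{0..1}. p > pc \<longrightarrow> (AE c in config_measure p. has_infinite_vertical_open_path c))"

section \<open>The game\<close>

datatype action1 = Top | Bottom
datatype action2 = Left | Right

fun move :: "vertex \<Rightarrow> action1 \<Rightarrow> action2 \<Rightarrow> vertex" where
  "move (x, y) Top Right = (x + 1, y + 1)"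
| "move (x, y) Top Left = (x - 1, y + 1)"
| "move (x, y) Bottom Right = (x + 1, y - 1)"
| "move (x, y) Bottom Left = (x - 1, y - 1)"

text \<open>Histories are lists of edges in chronological order. Strategies are total functions on
  \<^typ>\<open>edge list\<close>; a play from a vertex of \<^const>\<open>LL\<close> only evaluates them on
  \<open>lists EE\<close>, so their values elsewhere do not matter.
  The first component of the second player's strategy is the reply to \<^const>\<open>Top\<close>, the second
  component the reply to \<^const>\<open>Bottom\<close>.\<close>

type_synonym strategy1 = "edge list \<Rightarrow> action1"
type_synonym strategy2 = "edge list \<Rightarrow> action2 \<times> action2"

definition response :: "strategy2 \<Rightarrow> edge list \<Rightarrow> action1 \<Rightarrow> action2" where
  "response \<tau> h a = (case a of Top \<Rightarrow> fst (\<tau> h) | Bottom \<Rightarrow> snd (\<tau> h))"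

text \<open>Position of the token and history after \<open>m\<close> stages.\<close>

primrec play :: "vertex \<Rightarrow> strategy1 \<Rightarrow> strategy2 \<Rightarrow> nat \<Rightarrow> vertex \<times> edge list" where
  "play z \<sigma> \<tau> 0 = (z, [])"
| "play z \<sigma> \<tau> (Suc m) =
     (let (u, h) = play z \<sigma> \<tau> m; w = move u (\<sigma> h) (response \<tau> h (\<sigma> h))
      in (w, h @ [{u, w}]))"

text \<open>Stages are counted from 1, as usual in repeated games; the value at 0 is irrelevant.\<close>

definition crossed_edge :: "vertex \<Rightarrow> strategy1 \<Rightarrow> strategy2 \<Rightarrow> nat \<Rightarrow> edge" where
  "crossed_edge z \<sigma> \<tau> m = {fst (play z \<sigma> \<tau> (m - 1)), fst (play z \<sigma> \<tau> m)}"

definition total_cost :: "config \<Rightarrow> vertex \<Rightarrow> strategy1 \<Rightarrow> strategy2 \<Rightarrow> ereal" where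
  "total_cost c z \<sigma> \<tau> =
     limsup (\<lambda>n. ereal (1 / real n * (\<Sum>m=1..n. cost c (crossed_edge z \<sigma> \<tau> m))))"

definition has_value :: "config \<Rightarrow> vertex \<Rightarrow> real \<Rightarrow> bool" where
  "has_value c z w \<longleftrightarrow>
     (INF \<sigma>. SUP \<tau>. total_cost c z \<sigma> \<tau>) = ereal w \<and>
     (SUP \<tau>. INF \<sigma>. total_cost c z \<sigma> \<tau>) = ereal w"

definition is_almost_sure_value :: "real \<Rightarrow> real \<Rightarrow> bool" where
  "is_almost_sure_value p w \<longleftrightarrow> w \<in> {0..1} \<and> (AE c in config_measure p. \<forall>z\<in>LL. has_value c z w)"

section \<open>The critical parameter and the almost sure value are determined uniquely\<close>

lemma prob_space_config_measure: "prob_space (config_measure p)"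
  unfolding config_measure_def by (intro prob_space_PiM measure_pmf.prob_space_axioms)

lemma is_critical_parameter_unique:
  assumes "is_critical_parameter p" "is_critical_parameter q"
  shows "p = q"
proof -
  have False if "is_critical_parameter p" "is_critical_parameter q" "p < q" for p q
  proof -
    interpret prob_space "config_measure ((p + q) / 2)" by (rule prob_space_config_measure)
    have "AE c in config_measure ((p + q) / 2). has_infinite_vertical_open_path c"
      and "AE c in config_measure ((p + q) / 2). \<not> has_infinite_vertical_open_path c"
      using that unfolding is_critical_parameter_def by auto
    then have "AE c in config_measure ((p + q) / 2). False"
      by eventually_elim auto
    then show False by simp
  qed
  then show ?thesis using assms by (meson linorder_neqE)
qed

lemma is_almost_sure_value_unique:
  assumes "is_almost_sure_value p w" "is_almost_sure_value p w'"
  shows "w = w'"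
proof -
  interpret prob_space "config_measure p" by (rule prob_space_config_measure)
  have "(0, 0) \<in> LL" by (simp add: LL_def)
  have "AE c in config_measure p. \<forall>z\<in>LL. has_value c z w"
    and "AE c in config_measure p. \<forall>z\<in>LL. has_value c z w'"
    using assms by (auto simp: is_almost_sure_value_def)
  then have "AE c in config_measure p. w = w'"
    by eventually_elim (use \<open>(0, 0) \<in> LL\<close> in \<open>auto simp: has_value_def\<close>)
  then show ?thesis by simp
qed

lemma adjacent_move:
  assumes "z \<in> LL"
  shows "adjacent z (move z a b)"
  using assms by (cases z; cases a; cases b) (auto simp: adjacent_def LL_def dist_prod_def dist_real_def)

end

theory Submission
  imports Defs
begin

text \<open>
  Let \<open>r\<^sub>n\<close> be the rightmost point at height \<open>n\<close> that is joined to the half-line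
  \<open>{(x, 0). x \<le> 0}\<close> by an open upward path.  By subadditivity \<open>r\<^sub>n\<close> is dominated by a random walk,
  and if its drift were negative, the left and right edges of the cluster of a point would cross, so
  that no infinite vertical open path could exist.  Hence truncated means of \<open>r\<^sub>n\<close> are nonnegative above
  the critical parameter and, being polynomials in \<open>p\<close>, also at the critical parameter.  There \<open>r\<^sub>n / n\<close>
  therefore concentrates at some \<open>\<alpha> \<in> [0, 1)\<close>, and playing the same estimate against the configuration
  turned upside down shows that, with probability close to 1, an open path of height \<open>n\<close> stays within
  \<open>o(n)\<close> of the line \<open>x = \<alpha> y\<close>.

  For fixed \<open>n\<close> this is a local event, so it remains likely for \<open>p\<close> near the critical
  parameter, also below it.  Cutting the plane into strips parallel to this line and of width \<open>o(n)\<close>, a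
  union bound over the sequences of blocks that the token can traverse shows that at least half of
  the blocks on each sequence contain such a path.  The second player moves to the right until he
  meets a path, where he earns cost 1 for at least \<open>n\<close> stages, and loses only \<open>o(n)\<close> stages per
  strip.  So the value is close to 1 near the critical parameter, and it equals 1 there.
\<close>

section \<open>Events determined by finitely many edges\<close>

text \<open>All configurations are compared, not only those in the space of the product measure:
  \<open>Q\<close> is later evaluated at \<open>pull f c\<close> and at indicators
  \<open>\<lambda>e. e \<in> S\<close>, which need not lie there.\<close>

definition depends_on :: "edge set \<Rightarrow> (config \<Rightarrow> bool) \<Rightarrow> bool" where
  "depends_on F Q \<longleftrightarrow> (\<forall>c c'. (\<forall>e\<in>F. c e = c' e) \<longrightarrow> Q c = Q c')"

text \<open>The region \<open>A\<close> may be infinite, as a \<open>strip\<close> is. Events that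
  are local on disjoint regions are independent, whatever finite sets \<open>F\<close> lie behind
  them.\<close>

definition local_on :: "edge set \<Rightarrow> (config \<Rightarrow> bool) \<Rightarrow> bool" where
  "local_on A Q \<longleftrightarrow> (\<exists>F\<subseteq>A. finite F \<and> depends_on F Q)"

definition cprob :: "real \<Rightarrow> (config \<Rightarrow> bool) \<Rightarrow> real" where
  "cprob p Q = measure (config_measure p) {c \<in> space (config_measure p). Q c}"

lemma depends_onD: "depends_on F Q \<Longrightarrow> (\<And>e. e \<in> F \<Longrightarrow> c e = c' e) \<Longrightarrow> Q c = Q c'"
  unfolding depends_on_def by blast

lemma depends_on_conj:
  assumes "depends_on F P" "depends_on G Q"
  shows "depends_on (F \<union> G) (\<lambda>c. P c \<and> Q c)"
  unfolding depends_on_def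
proof (intro allI impI)
  fix c c' :: config assume "\<forall>e\<in>F \<union> G. c e = c' e"
  then have "P c = P c'" "Q c = Q c'"
    using depends_onD[OF assms(1), of c c'] depends_onD[OF assms(2), of c c'] by auto
  then show "(P c \<and> Q c) = (P c' \<and> Q c')" by simp
qed

lemma local_on_mono: "local_on A Q \<Longrightarrow> A \<subseteq> B \<Longrightarrow> local_on B Q"
  unfolding local_on_def by blast

lemma local_on_const [simp, intro]: "local_on A (\<lambda>c. P)"
  unfolding local_on_def depends_on_def by auto

lemma local_on_edge: "e \<in> A \<Longrightarrow> local_on A (\<lambda>c. c e)"
  unfolding local_on_def depends_on_def by (intro exI[of _ "{e}"]) auto

lemma local_on_not: "local_on A Q \<Longrightarrow> local_on A (\<lambda>c. \<not> Q c)"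
  unfolding local_on_def depends_on_def by blast

lemma local_on_conj:
  assumes "local_on A P" "local_on A Q" shows "local_on A (\<lambda>c. P c \<and> Q c)"
proof -
  obtain F where F: "F \<subseteq> A" "finite F" "depends_on F P"
    using assms(1) unfolding local_on_def by blast
  obtain G where G: "G \<subseteq> A" "finite G" "depends_on G Q"
    using assms(2) unfolding local_on_def by blast
  have "depends_on (F \<union> G) (\<lambda>c. P c \<and> Q c)"
    by (rule depends_on_conj[OF F(3) G(3)])
  then show ?thesis
    unfolding local_on_def using F G by (intro exI[of _ "F \<union> G"]) simp
qed

lemma local_on_disj:
  assumes "local_on A P" "local_on A Q" shows "local_on A (\<lambda>c. P c \<or> Q c)"
  using local_on_not[OF local_on_conj[OF local_on_not[OF assms(1)] local_on_not[OF assms(2)]]] by simp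

lemma local_on_guard: "(P \<Longrightarrow> local_on A Q) \<Longrightarrow> local_on A (\<lambda>c. P \<and> Q c)"
  by (cases P) auto

lemma local_on_Bex:
  assumes "finite I" "\<And>i. i \<in> I \<Longrightarrow> local_on A (Q i)" shows "local_on A (\<lambda>c. \<exists>i\<in>I. Q i c)"
  using assms by (induction I rule: finite_induct) (auto intro: local_on_disj)

lemma local_on_Ball:
  assumes "finite I" "\<And>i. i \<in> I \<Longrightarrow> local_on A (Q i)" shows "local_on A (\<lambda>c. \<forall>i\<in>I. Q i c)"
  using assms by (induction I rule: finite_induct) (auto intro: local_on_conj)

section \<open>Probabilities of local events as polynomials in the parameter\<close>

definition weight :: "real \<Rightarrow> edge set \<Rightarrow> edge set \<Rightarrow> real" where
  "weight p F S = (\<Prod>e\<in>F. if e \<in> S then p else 1 - p)"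

text \<open>The event is a disjoint union of cylinders, one for each possible set \<open>S\<close>
  of open edges in \<open>F\<close>, and \<open>weight p F S\<close> is the probability of such a
  cylinder.\<close>

lemma
  assumes p: "p \<in> {0..1}" and F: "finite F" "F \<subseteq> EE" and Q: "depends_on F Q"
  shows sets_depends_on: "{c \<in> space (config_measure p). Q c} \<in> sets (config_measure p)"
    and cprob_depends_on: "cprob p Q = (\<Sum>S\<in>Pow F. of_bool (Q (\<lambda>e. e \<in> S)) * weight p F S)"
proof -
  interpret product_prob_space "\<lambda>_. measure_pmf (bernoulli_pmf p)" EE
    by unfold_locales
  define C where "C S = {c \<in> space (config_measure p). \<forall>e\<in>F. c e \<in> {e \<in> S}}" for S :: "edge set"
  have C_sets: "C S \<in> sets (config_measure p)" for S
    unfolding C_def config_measure_def using F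
    by (intro sets.sets_Collect_finite_All sets_Collect_single') auto
  have C_meas: "measure (config_measure p) (C S) = weight p F S" for S
  proof -
    have "C S = emb EE F (Pi\<^sub>E F (\<lambda>e. {e \<in> S}))"
      unfolding C_def config_measure_def prod_emb_def using F(2) by (auto simp: space_PiM)
    then show ?thesis
      using p measure_PiM_emb[OF F(2,1), of "\<lambda>e. {e \<in> S}"]
      by (auto simp: config_measure_def weight_def measure_pmf_single intro!: prod.cong)
  qed
  define \<S> where "\<S> = {S \<in> Pow F. Q (\<lambda>e. e \<in> S)}"
  have eq: "{c \<in> space (config_measure p). Q c} = (\<Union>S\<in>\<S>. C S)"
  proof (intro set_eqI iffI)
    fix c assume c: "c \<in> {c \<in> space (config_measure p). Q c}"
    have "Q (\<lambda>e. e \<in> {e \<in> F. c e})"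
      using c depends_onD[OF Q, of c "\<lambda>e. e \<in> {e \<in> F. c e}"] by auto
    then show "c \<in> (\<Union>S\<in>\<S>. C S)"
      using c unfolding \<S>_def C_def by (intro UN_I[of "{e \<in> F. c e}"]) auto
  next
    fix c assume "c \<in> (\<Union>S\<in>\<S>. C S)"
    then obtain S where S: "S \<in> \<S>" "c \<in> C S" by blast
    then show "c \<in> {c \<in> space (config_measure p). Q c}"
      using depends_onD[OF Q, of c "\<lambda>e. e \<in> S"] unfolding \<S>_def C_def by auto
  qed
  have fin: "finite \<S>" unfolding \<S>_def using F by auto
  show "{c \<in> space (config_measure p). Q c} \<in> sets (config_measure p)"
    unfolding eq using fin C_sets by auto
  have "disjoint_family_on C \<S>"
    unfolding disjoint_family_on_def C_def \<S>_def by fastforce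
  then have "cprob p Q = (\<Sum>S\<in>\<S>. weight p F S)"
    unfolding cprob_def eq C_meas[symmetric] using fin C_sets
    by (intro finite_measure.finite_measure_finite_Union
        prob_space.finite_measure[OF prob_space_config_measure]) auto
  also have "\<dots> = (\<Sum>S\<in>Pow F. of_bool (Q (\<lambda>e. e \<in> S)) * weight p F S)"
    unfolding \<S>_def using F by (intro sum.mono_neutral_cong_left) auto
  finally show "cprob p Q = (\<Sum>S\<in>Pow F. of_bool (Q (\<lambda>e. e \<in> S)) * weight p F S)" .
qed

lemma sets_local_on:
  "p \<in> {0..1} \<Longrightarrow> local_on EE Q \<Longrightarrow>
    {c \<in> space (config_measure p). Q c} \<in> sets (config_measure p)"
  unfolding local_on_def using sets_depends_on by blast

lemma cprob_nonneg [simp]: "0 \<le> cprob p Q"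
  unfolding cprob_def by simp

lemma cprob_le_1 [simp]: "cprob p Q \<le> 1"
  unfolding cprob_def using prob_space.prob_le_1[OF prob_space_config_measure] .

lemma cprob_mono:
  assumes "p \<in> {0..1}" "local_on EE R" "\<And>c. Q c \<Longrightarrow> R c"
  shows "cprob p Q \<le> cprob p R"
proof -
  interpret prob_space "config_measure p" by (rule prob_space_config_measure)
  show ?thesis unfolding cprob_def
    by (rule finite_measure_mono) (use sets_local_on[OF assms(1,2)] assms(3) in auto)
qed

lemma cprob_Bex_le:
  assumes "p \<in> {0..1}" "finite I" "\<And>i. i \<in> I \<Longrightarrow> local_on EE (Q i)"
  shows "cprob p (\<lambda>c. \<exists>i\<in>I. Q i c) \<le> (\<Sum>i\<in>I. cprob p (Q i))"
proof -
  interpret prob_space "config_measure p" by (rule prob_space_config_measure)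
  have *: "{c \<in> space (config_measure p). \<exists>i\<in>I. Q i c}
      = (\<Union>i\<in>I. {c \<in> space (config_measure p). Q i c})"
    by auto
  show ?thesis unfolding cprob_def * 
    by (rule finite_measure_subadditive_finite) (use assms sets_local_on in auto)
qed

lemma cprob_disj_le:
  assumes "p \<in> {0..1}" "local_on EE Q" "local_on EE R"
  shows "cprob p (\<lambda>c. Q c \<or> R c) \<le> cprob p Q + cprob p R"
  using cprob_Bex_le[OF assms(1), of "UNIV :: bool set" "\<lambda>b. if b then Q else R"] assms(2,3)
  by (auto simp: UNIV_bool ex_bool_eq disj_commute add.commute)

lemma cprob_not:
  assumes "p \<in> {0..1}" "local_on EE Q"
  shows "cprob p (\<lambda>c. \<not> Q c) = 1 - cprob p Q"
proof -
  interpret prob_space "config_measure p" by (rule prob_space_config_measure)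
  show ?thesis unfolding cprob_def using sets_local_on[OF assms]
    by (rule prob_neg[unfolded Let_def])
qed

text \<open>The probability of a local event is a polynomial in \<open>p\<close>. This carries the
  nonnegative drift down to the critical parameter, and the crossing of a fixed tube from there to
  all nearby parameters.\<close>

lemma continuous_on_cprob:
  assumes "local_on EE Q"
  shows "continuous_on {0..1} (\<lambda>p. cprob p Q)"
proof -
  obtain F where F: "F \<subseteq> EE" "finite F" "depends_on F Q"
    using assms unfolding local_on_def by blast
  have edge: "continuous_on {0..1} (\<lambda>p :: real. if e \<in> S then p else 1 - p)" for e :: edge and S
    by (cases "e \<in> S") (auto intro!: continuous_intros)
  have "continuous_on {0..1} (\<lambda>p. \<Sum>S\<in>Pow F. of_bool (Q (\<lambda>e. e \<in> S)) * weight p F S)"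
    unfolding weight_def by (intro continuous_intros) (rule edge)
  then show ?thesis
    using continuous_on_cong[OF refl cprob_depends_on[OF _ F(2,1,3)], of "{0..1}" "\<lambda>p. p"] by simp
qed

text \<open>The costs are i.i.d., so an injective relabelling \<open>T\<close> of the edges turns
  cylinders into cylinders of the same weight.\<close>

lemma
  assumes "local_on A Q" and T: "inj T" "T ` A \<subseteq> B"
  shows local_on_compose: "local_on B (\<lambda>c. Q (\<lambda>e. c (T e)))"
    and cprob_compose:
      "p \<in> {0..1} \<Longrightarrow> A \<subseteq> EE \<Longrightarrow> B \<subseteq> EE \<Longrightarrow> cprob p (\<lambda>c. Q (\<lambda>e. c (T e))) = cprob p Q"
proof -
  obtain F where F: "F \<subseteq> A" "finite F" "depends_on F Q"
    using assms unfolding local_on_def by blast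
  have TF: "T ` F \<subseteq> B" "finite (T ` F)" "depends_on (T ` F) (\<lambda>c. Q (\<lambda>e. c (T e)))"
    using F T unfolding depends_on_def by (auto simp: image_subset_iff subset_iff)
  then show "local_on B (\<lambda>c. Q (\<lambda>e. c (T e)))"
    unfolding local_on_def by blast
  assume p: "p \<in> {0..1}" and AB: "A \<subseteq> EE" "B \<subseteq> EE"
  have w: "weight p (T ` F) (T ` S) = weight p F S" for S
    unfolding weight_def using T(1)
    by (subst prod.reindex) (auto simp: inj_image_mem_iff intro: inj_on_subset)
  have "cprob p (\<lambda>c. Q (\<lambda>e. c (T e)))
      = (\<Sum>S\<in>Pow (T ` F). of_bool (Q (\<lambda>e. T e \<in> S)) * weight p (T ` F) S)"
    by (rule cprob_depends_on) (use p AB TF in auto)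
  also have "Pow (T ` F) = image T ` Pow F"
    by (simp add: image_Pow_surj)
  also have "(\<Sum>S\<in>image T ` Pow F. of_bool (Q (\<lambda>e. T e \<in> S)) * weight p (T ` F) S)
      = (\<Sum>S\<in>Pow F. of_bool (Q (\<lambda>e. e \<in> S)) * weight p F S)"
    using T(1) inj_on_subset[OF inj_on_image_Pow[OF T(1)]]
    by (subst sum.reindex) (simp_all add: inj_image_mem_iff w)
  also have "\<dots> = cprob p Q"
    by (rule cprob_depends_on[symmetric]) (use p AB F in auto)
  finally show "cprob p (\<lambda>c. Q (\<lambda>e. c (T e))) = cprob p Q" .
qed

lemma cprob_indep:
  assumes p: "p \<in> {0..1}" and A: "local_on A P" and B: "local_on B Q"
    and AB: "A \<subseteq> EE" "B \<subseteq> EE" "A \<inter> B = {}"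
  shows "cprob p (\<lambda>c. P c \<and> Q c) = cprob p P * cprob p Q"
proof -
  obtain F where F: "F \<subseteq> A" "finite F" "depends_on F P"
    using A unfolding local_on_def by blast
  obtain G where G: "G \<subseteq> B" "finite G" "depends_on G Q"
    using B unfolding local_on_def by blast
  have FG: "F \<inter> G = {}" using F G AB by blast
  \<comment> \<open>A subset of \<open>F \<union> G\<close> is a pair of subsets of the two parts,
    so the sum over cylinders factors.\<close>
  define u where "u = (\<lambda>(S, T). S \<union> T :: edge set)"
  have inj: "inj_on u (Pow F \<times> Pow G)"
    unfolding u_def inj_on_def using FG by auto blast+
  have img: "u ` (Pow F \<times> Pow G) = Pow (F \<union> G)"
  proof (intro equalityI subsetI)
    fix X assume "X \<in> Pow (F \<union> G)"
    then show "X \<in> u ` (Pow F \<times> Pow G)"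
      by (intro image_eqI[of _ _ "(X \<inter> F, X \<inter> G)"]) (auto simp: u_def)
  qed (auto simp: u_def)
  have P: "P (\<lambda>e. e \<in> S \<or> e \<in> T) = P (\<lambda>e. e \<in> S)" if "S \<subseteq> F" "T \<subseteq> G" for S T
    using that FG by (intro depends_onD[OF F(3)]) auto
  have Q: "Q (\<lambda>e. e \<in> S \<or> e \<in> T) = Q (\<lambda>e. e \<in> T)" if "S \<subseteq> F" "T \<subseteq> G" for S T
    using that FG by (intro depends_onD[OF G(3)]) auto
  have w: "weight p (F \<union> G) (S \<union> T) = weight p F S * weight p G T" if "S \<subseteq> F" "T \<subseteq> G" for S T
  proof -
    have "weight p F (S \<union> T) = weight p F S" "weight p G (S \<union> T) = weight p G T"
      unfolding weight_def using that FG by (auto intro!: prod.cong)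
    then show ?thesis
      unfolding weight_def using F G FG by (subst prod.union_disjoint) auto
  qed
  have indep_dep: "depends_on (F \<union> G) (\<lambda>c. P c \<and> Q c)"
    by (rule depends_on_conj[OF F(3) G(3)])
  have "cprob p (\<lambda>c. P c \<and> Q c)
      = (\<Sum>X\<in>Pow (F \<union> G). of_bool (P (\<lambda>e. e \<in> X) \<and> Q (\<lambda>e. e \<in> X)) * weight p (F \<union> G) X)"
    by (rule cprob_depends_on) (use p AB F G indep_dep in auto)
  also have "\<dots> = (\<Sum>(S, T)\<in>Pow F \<times> Pow G.
      (of_bool (P (\<lambda>e. e \<in> S)) * weight p F S) * (of_bool (Q (\<lambda>e. e \<in> T)) * weight p G T))"
    unfolding img[symmetric] sum.reindex[OF inj]
    by (intro sum.cong) (auto simp: u_def P Q w)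
  also have "\<dots> = cprob p P * cprob p Q"
    unfolding sum.cartesian_product[symmetric] sum_product[symmetric]
    using cprob_depends_on[OF p F(2) _ F(3)] cprob_depends_on[OF p G(2) _ G(3)] F G AB by auto
  finally show ?thesis .
qed

lemma cprob_indep_Ball:
  assumes p: "p \<in> {0..1}" and "finite I" and "\<And>i. i \<in> I \<Longrightarrow> local_on (A i) (Q i)"
    and "\<And>i. i \<in> I \<Longrightarrow> A i \<subseteq> EE"
    and "\<And>i j. i \<in> I \<Longrightarrow> j \<in> I \<Longrightarrow> i \<noteq> j \<Longrightarrow> A i \<inter> A j = {}"
  shows "cprob p (\<lambda>c. \<forall>i\<in>I. Q i c) = (\<Prod>i\<in>I. cprob p (Q i))"
  using assms(2-)
proof (induction I rule: finite_induct)
  case empty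
  then show ?case
    using prob_space.prob_space[OF prob_space_config_measure] by (simp add: cprob_def)
next
  case (insert i I)
  have "local_on (\<Union>j\<in>I. A j) (\<lambda>c. \<forall>j\<in>I. Q j c)"
    using insert by (intro local_on_Ball) (auto intro: local_on_mono)
  moreover have "local_on (A i) (Q i)"
    using insert by blast
  moreover have "A i \<inter> (\<Union>j\<in>I. A j) = {}"
    using insert by fastforce
  ultimately have "cprob p (\<lambda>c. Q i c \<and> (\<forall>j\<in>I. Q j c))
      = cprob p (Q i) * cprob p (\<lambda>c. \<forall>j\<in>I. Q j c)"
    using insert(5) by (intro cprob_indep[OF p, of "A i" _ "\<Union>j\<in>I. A j"]) auto
  then show ?case using insert by simp
qed

section \<open>Symmetries of the lattice\<close>

lemma adjacent_iff:
  "adjacent (x, y) (x', y') \<longleftrightarrow> even (x + y) \<and> \<bar>x - x'\<bar> = 1 \<and> \<bar>y - y'\<bar> = 1"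
proof -
  have "dist (real_of_int x, real_of_int y) (real_of_int x', real_of_int y') = sqrt 2
      \<longleftrightarrow> real_of_int ((x - x')\<^sup>2 + (y - y')\<^sup>2) = real_of_int 2"
    by (simp add: dist_prod_def dist_real_def)
  also have "\<dots> \<longleftrightarrow> (x - x')\<^sup>2 + (y - y')\<^sup>2 = 2"
    unfolding of_int_eq_iff ..
  also have "\<dots> \<longleftrightarrow> \<bar>x - x'\<bar> = 1 \<and> \<bar>y - y'\<bar> = 1"
  proof
    assume eq: "(x - x')\<^sup>2 + (y - y')\<^sup>2 = 2"
    have "\<bar>a\<bar> < 2" if "a\<^sup>2 \<le> 2" for a :: int
    proof (rule ccontr)
      assume "\<not> \<bar>a\<bar> < 2"
      then have "2\<^sup>2 \<le> \<bar>a\<bar>\<^sup>2" by (intro power_mono) auto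
      then show False using that by simp
    qed
    then have "\<bar>x - x'\<bar> < 2" "\<bar>y - y'\<bar> < 2"
      using eq by (smt (verit) zero_le_power2)+
    then have "\<bar>x - x'\<bar> = 0 \<or> \<bar>x - x'\<bar> = 1" "\<bar>y - y'\<bar> = 0 \<or> \<bar>y - y'\<bar> = 1" by linarith+
    moreover have "\<bar>x - x'\<bar>\<^sup>2 + \<bar>y - y'\<bar>\<^sup>2 = 2" using eq by simp
    moreover have "a = 0 \<or> a = 1 \<Longrightarrow> b = 0 \<or> b = 1 \<Longrightarrow> a\<^sup>2 + b\<^sup>2 = 2 \<Longrightarrow> a = 1 \<and> b = 1" for a b :: int
      by auto
    ultimately show "\<bar>x - x'\<bar> = 1 \<and> \<bar>y - y'\<bar> = 1" by blast
  next
    assume "\<bar>x - x'\<bar> = 1 \<and> \<bar>y - y'\<bar> = 1"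
    then have "\<bar>x - x'\<bar>\<^sup>2 + \<bar>y - y'\<bar>\<^sup>2 = 2" by simp
    then show "(x - x')\<^sup>2 + (y - y')\<^sup>2 = 2" by simp
  qed
  finally have 1: "dist (real_of_int x, real_of_int y) (real_of_int x', real_of_int y') = sqrt 2
    \<longleftrightarrow> \<bar>x - x'\<bar> = 1 \<and> \<bar>y - y'\<bar> = 1" .
  have "even (x + y) = even (x' + y')" if "\<bar>x - x'\<bar> = 1" "\<bar>y - y'\<bar> = 1"
    using that by presburger
  then show ?thesis
    unfolding adjacent_def LL_def fst_conv snd_conv 1 by auto
qed

lemma adjacent_commute: "adjacent u w \<longleftrightarrow> adjacent w u"
  unfolding adjacent_def by (auto simp: dist_commute)

lemma edge_in_EE: "{u, w} \<in> EE \<longleftrightarrow> adjacent u w"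
  unfolding EE_def mem_Collect_eq using adjacent_commute by (metis doubleton_eq_iff)

text \<open>The configuration as seen through \<open>f\<close>: for \<open>f = (+) z\<close> it is
  \<open>c\<close> viewed from \<open>z\<close> as the new origin.\<close>

definition pull :: "(vertex \<Rightarrow> vertex) \<Rightarrow> config \<Rightarrow> config" where
  "pull f c = (\<lambda>e. c (f ` e))"

definition symmetry :: "(vertex \<Rightarrow> vertex) \<Rightarrow> bool" where
  "symmetry f \<longleftrightarrow> inj f \<and> (\<forall>u w. adjacent u w \<longrightarrow> adjacent (f u) (f w))"

definition reflect :: "vertex \<Rightarrow> vertex" where
  "reflect = (\<lambda>(x, y). (- x, y))"

text \<open>The half turn that exchanges the origin with \<open>z\<close>; its centre is
  \<open>z / 2\<close>.\<close>

definition rotate_about :: "vertex \<Rightarrow> vertex \<Rightarrow> vertex" where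
  "rotate_about z = (\<lambda>u. z - u)"

lemma symmetry_translate: "z \<in> LL \<Longrightarrow> symmetry ((+) z)"
  unfolding symmetry_def LL_def by (auto simp: inj_on_def adjacent_iff)

lemma symmetry_reflect: "symmetry reflect"
  unfolding symmetry_def reflect_def by (auto simp: inj_on_def adjacent_iff)

lemma symmetry_rotate_about: "z \<in> LL \<Longrightarrow> symmetry (rotate_about z)"
  unfolding symmetry_def LL_def rotate_about_def by (auto simp: inj_on_def adjacent_iff)

lemma symmetry_image_EE: "symmetry f \<Longrightarrow> image f ` EE \<subseteq> EE"
  unfolding symmetry_def EE_def by blast

lemma
  assumes "symmetry f" "local_on A Q"
  shows local_on_pull: "image f ` A \<subseteq> B \<Longrightarrow> local_on B (\<lambda>c. Q (pull f c))"
    and cprob_pull: "p \<in> {0..1} \<Longrightarrow> A \<subseteq> EE \<Longrightarrow> cprob p (\<lambda>c. Q (pull f c)) = cprob p Q"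
proof -
  have inj: "inj (image f)"
    using assms(1) unfolding symmetry_def by (metis inj_image_eq_iff injI)
  show "image f ` A \<subseteq> B \<Longrightarrow> local_on B (\<lambda>c. Q (pull f c))"
    unfolding pull_def using local_on_compose[OF assms(2) inj] by blast
  show "p \<in> {0..1} \<Longrightarrow> A \<subseteq> EE \<Longrightarrow> cprob p (\<lambda>c. Q (pull f c)) = cprob p Q"
    unfolding pull_def
    using cprob_compose[OF assms(2) inj, of EE p] symmetry_image_EE[OF assms(1)] by blast
qed

section \<open>Open upward paths and the right edge\<close>

text \<open>\<open>P\<close> encodes both the region to which paths are confined and, through its
  values at height 0, their starting points. Membership of the predecessor in \<open>P\<close> is
  spelled out so that only edges inside the region are ever inspected.\<close>

primrec reach :: "(int \<Rightarrow> nat \<Rightarrow> bool) \<Rightarrow> config \<Rightarrow> nat \<Rightarrow> int \<Rightarrow> bool" where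
  "reach P c 0 x \<longleftrightarrow> P x 0"
| "reach P c (Suc n) x \<longleftrightarrow> P x (Suc n) \<and>
     (P (x - 1) n \<and> reach P c n (x - 1) \<and> c {(x - 1, int n), (x, int n + 1)} \<or>
      P (x + 1) n \<and> reach P c n (x + 1) \<and> c {(x + 1, int n), (x, int n + 1)})"

definition region_edges :: "(int \<Rightarrow> nat \<Rightarrow> bool) \<Rightarrow> nat \<Rightarrow> edge set" where
  "region_edges P n =
     {{(x, int m), (x', int m + 1)} |x x' m. m < n \<and> P x m \<and> P x' (Suc m) \<and> \<bar>x - x'\<bar> = 1}"

lemma region_edges_mono: "m \<le> n \<Longrightarrow> region_edges P m \<subseteq> region_edges P n"
  unfolding region_edges_def by fastforce

lemma region_edges_subset_EE:
  assumes "\<And>x m. P x m \<Longrightarrow> even (x + int m)"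
  shows "region_edges P n \<subseteq> EE"
proof
  fix e assume "e \<in> region_edges P n"
  then obtain x x' m where "e = {(x, int m), (x', int m + 1)}" "P x m" "\<bar>x - x'\<bar> = 1"
    unfolding region_edges_def by blast
  then show "e \<in> EE"
    using assms[of x m] by (simp add: edge_in_EE adjacent_iff)
qed

lemma local_on_reach: "local_on (region_edges P n) (\<lambda>c. reach P c n x)"
proof (induction n arbitrary: x)
  case (Suc n)
  have *: "local_on (region_edges P (Suc n))
      (\<lambda>c. P z n \<and> reach P c n z \<and> c {(z, int n), (x, int n + 1)})"
    if "P x (Suc n)" "\<bar>z - x\<bar> = 1" for z
  proof (rule local_on_guard)
    assume "P z n"
    then have "{(z, int n), (x, int n + 1)} \<in> region_edges P (Suc n)"
      unfolding region_edges_def using that by blast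
    then show "local_on (region_edges P (Suc n)) (\<lambda>c. reach P c n z \<and> c {(z, int n), (x, int n + 1)})"
      using local_on_mono[OF Suc region_edges_mono[of n "Suc n"]]
      by (intro local_on_conj local_on_edge) auto
  qed
  show ?case
    unfolding reach.simps by (intro local_on_guard local_on_disj *) auto
qed auto

lemma reach_region: "reach P c n x \<Longrightarrow> P x n"
  by (cases n) auto

lemma reach_SucI:
  assumes "reach P c n z" "P x (Suc n)" "\<bar>z - x\<bar> = 1" "c {(z, int n), (x, int n + 1)}"
  shows "reach P c (Suc n) x"
proof -
  have "z = x - 1 \<or> z = x + 1" using assms(3) by auto
  then show ?thesis using assms reach_region[OF assms(1)] by auto
qed

text \<open>Predecessors are traced back from \<open>x\<close>. The intermediate points are recorded
  as reached too, so that each of them can be compared with the right edge at its height.\<close>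

lemma reach_path:
  assumes "reach P c n x"
  shows "\<exists>f. f n = x \<and> (\<forall>m\<le>n. P (f m) m \<and> reach P c m (f m)) \<and>
    (\<forall>m<n. \<bar>f (Suc m) - f m\<bar> = 1 \<and> c {(f m, int m), (f (Suc m), int m + 1)})"
  using assms
proof (induction n arbitrary: x)
  case 0
  then show ?case by (intro exI[of _ "\<lambda>_. x"]) auto
next
  case (Suc n)
  then obtain y where y: "\<bar>x - y\<bar> = 1" "reach P c n y" "c {(y, int n), (x, int n + 1)}"
    by force
  from Suc.IH[OF y(2)] obtain f where f: "f n = y" "\<forall>m\<le>n. P (f m) m \<and> reach P c m (f m)"
    "\<forall>m<n. \<bar>f (Suc m) - f m\<bar> = 1 \<and> c {(f m, int m), (f (Suc m), int m + 1)}"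
    by blast
  show ?case
    using f y Suc.prems reach_region[OF Suc.prems]
    by (intro exI[of _ "f(Suc n := x)"]) (auto simp: less_Suc_eq le_Suc_eq simp del: reach.simps)
qed

lemma path_reach:
  assumes "\<And>m. m \<le> n \<Longrightarrow> P (f m) m"
    "\<And>m. m < n \<Longrightarrow> \<bar>f (Suc m) - f m\<bar> = 1 \<and> c {(f m, int m), (f (Suc m), int m + 1)}"
  shows "reach P c n (f n)"
  using assms
proof (induction n)
  case (Suc n)
  have "reach P c n (f n)" using Suc by simp
  then show ?case
    using Suc.prems(1)[of "Suc n"] Suc.prems(2)[of n]
    by (intro reach_SucI[of _ _ _ "f n"]) auto
qed auto

section \<open>The right edge of the cluster of a half-line\<close>

definition half_line :: "int \<Rightarrow> nat \<Rightarrow> bool" where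
  "half_line x n \<longleftrightarrow> even (x + int n) \<and> (n = 0 \<longrightarrow> x \<le> 0)"

text \<open>The right edge \<open>r\<^sub>n\<close> is the rightmost point at height \<open>n\<close> that can be reached from the
  half-line; \<open>right_edge_ge n a\<close> is the event \<open>r\<^sub>n \<ge> a\<close> and \<open>right_edge_eq n b\<close> the event \<open>r\<^sub>n = b\<close>.\<close>

definition right_edge_ge :: "nat \<Rightarrow> int \<Rightarrow> config \<Rightarrow> bool" where
  "right_edge_ge n a c \<longleftrightarrow> (\<exists>x\<in>{a..int n}. reach half_line c n x)"

definition right_edge_eq :: "nat \<Rightarrow> int \<Rightarrow> config \<Rightarrow> bool" where
  "right_edge_eq n b c \<longleftrightarrow> reach half_line c n b \<and> \<not> right_edge_ge n (b + 1) c"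

definition layer :: "int \<Rightarrow> int \<Rightarrow> edge set" where
  "layer a b = {e \<in> EE. snd ` e \<subseteq> {a..b}}"

lemma layer_subset_EE: "layer a b \<subseteq> EE"
  unfolding layer_def by auto

text \<open>The two layers share the vertices at height \<open>b\<close> but no edge, because every
  edge changes the height. Hence what happens below and above a given height is independent.\<close>

lemma layer_disjoint: "layer a b \<inter> layer b d = {}"
proof -
  have False if e: "e \<in> layer a b" "e \<in> layer b d" for e
  proof -
    obtain u w where "e = {u, w}" "adjacent u w"
      using e(1) unfolding layer_def EE_def by blast
    then show False
      using e unfolding layer_def by (cases u; cases w) (auto simp: adjacent_iff)
  qed
  then show ?thesis by blast
qed

lemma local_on_reach_half_line: "local_on (layer 0 (int n)) (\<lambda>c. reach half_line c n x)"
proof (rule local_on_mono[OF local_on_reach])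
  have "region_edges half_line n \<subseteq> EE"
    by (rule region_edges_subset_EE) (simp add: half_line_def)
  then show "region_edges half_line n \<subseteq> layer 0 (int n)"
    unfolding layer_def region_edges_def by auto
qed

lemma local_on_right_edge_ge: "local_on (layer 0 (int n)) (right_edge_ge n a)"
  unfolding right_edge_ge_def[abs_def]
  by (intro local_on_Bex local_on_reach_half_line) auto

lemma local_on_right_edge_eq: "local_on (layer 0 (int n)) (right_edge_eq n a)"
  unfolding right_edge_eq_def[abs_def]
  by (intro local_on_conj local_on_not local_on_reach_half_line local_on_right_edge_ge)

lemma reach_half_line_le: "reach half_line c n x \<Longrightarrow> x \<le> int n"
  by (induction n arbitrary: x) (force simp: half_line_def)+

text \<open>A path gains at most one unit to the right per level, so the upper bound
  \<open>n\<close> in the definition, which makes the event local, excludes no point.\<close>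

lemma right_edge_ge_iff: "right_edge_ge n a c \<longleftrightarrow> (\<exists>x\<ge>a. reach half_line c n x)"
  unfolding right_edge_ge_def using reach_half_line_le by fastforce

section \<open>Subadditivity of the right edge\<close>

lemma reach_half_line_ancestor:
  "reach half_line c (k + m) x \<Longrightarrow> \<exists>x'\<ge>x - int m. reach half_line c k x'"
proof (induction m arbitrary: x)
  case (Suc m)
  from Suc.prems obtain z where "reach half_line c (k + m) z" "z \<ge> x - 1"
    by force
  with Suc.IH[of z] obtain x' where "x' \<ge> z - int m" "reach half_line c k x'" by blast
  with \<open>z \<ge> x - 1\<close> show ?case by (intro exI[of _ x']) simp
qed auto

lemma pull_translate_edge:
  "pull ((+) (b, k)) c {(x, y), (x', y')} = c {(b + x, k + y), (b + x', k + y')}"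
  unfolding pull_def by simp

text \<open>Restarting at height \<open>k\<close> from the full half-line to the left of
  \<open>b\<close> adds starting points, so it can only reach more.\<close>

lemma reach_half_line_compose:
  assumes "\<And>x. reach half_line c k x \<Longrightarrow> x \<le> b" "even (b + int k)"
  shows "reach half_line c (k + m) x \<Longrightarrow> reach half_line (pull ((+) (b, int k)) c) m (x - b)"
proof (induction m arbitrary: x)
  case 0
  then have "half_line x k" "x \<le> b" using assms(1) reach_region[of half_line c k x] by auto
  then show ?case using assms(2) by (auto simp: half_line_def)
next
  case (Suc m)
  from Suc.prems obtain z where z: "z = x - 1 \<or> z = x + 1" "reach half_line c (k + m) z"
    "c {(z, int (k + m)), (x, int (k + m) + 1)}"
    by force
  have "pull ((+) (b, int k)) c {(z - b, int m), (x - b, int m + 1)}"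
    using z(3) by (simp add: pull_translate_edge add.assoc)
  moreover have "half_line (x - b) (Suc m)"
    using assms(2) reach_region[OF Suc.prems] unfolding half_line_def by (auto simp: algebra_simps)
  moreover have "reach half_line (pull ((+) (b, int k)) c) m (z - b)"
    by (rule Suc.IH[OF z(2)])
  moreover have "\<bar>(z - b) - (x - b)\<bar> = 1"
    using z(1) by auto
  ultimately show ?case
    by (intro reach_SucI[of _ _ _ "z - b"])
qed

text \<open>Here \<open>b\<close> is \<open>r\<^sub>k\<close>. The upper part of the path, seen from
  \<open>(b, k)\<close>, starts in the half-line, so \<open>r\<^sub>k\<^sub>+\<^sub>m - b\<close> is
  at most the right edge of the restarted process.\<close>

lemma right_edge_ge_decompose:
  assumes "right_edge_ge (k + m) a c"
  shows "\<exists>b\<in>{a - int m..int k}. right_edge_eq k b c \<and>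
    right_edge_ge m (a - b) (pull ((+) (b, int k)) c)"
proof -
  obtain x where x: "x \<ge> a" "reach half_line c (k + m) x"
    using assms unfolding right_edge_ge_iff by blast
  \<comment> \<open>Cutting off at \<open>a - m\<close> makes the set finite; it stays nonempty
    because the path to \<open>x\<close> has an ancestor at height \<open>k\<close> that is not
    further left.\<close>
  define S where "S = {x'\<in>{a - int m..int k}. reach half_line c k x'}"
  have S: "finite S" "S \<noteq> {}"
    using reach_half_line_ancestor[OF x(2)] reach_half_line_le[of c k] x(1)
    unfolding S_def by fastforce+
  define b where "b = Max S"
  have b: "b \<in> S" unfolding b_def using S by (rule Max_in)
  have le: "x' \<le> b" if "reach half_line c k x'" for x'
  proof (cases "x' \<ge> a - int m")
    case True
    then have "x' \<in> S" unfolding S_def using that reach_half_line_le[OF that] by auto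
    then show ?thesis unfolding b_def using S by simp
  next
    case False
    then show ?thesis using b unfolding S_def by auto
  qed
  have "even (b + int k)"
    using b reach_region[of half_line c k b] unfolding S_def half_line_def by auto
  then have "reach half_line (pull ((+) (b, int k)) c) m (x - b)"
    using reach_half_line_compose[of c k b m x] le x(2) by blast
  then have "right_edge_ge m (a - b) (pull ((+) (b, int k)) c)"
    unfolding right_edge_ge_iff using x(1) by (intro exI[of _ "x - b"]) auto
  moreover have "right_edge_eq k b c"
    using b le unfolding S_def right_edge_eq_def right_edge_ge_iff by fastforce
  ultimately show ?thesis
    using b unfolding S_def by blast
qed

text \<open>The restarted process uses only edges above height \<open>k\<close> and is a translate
  of the original, so \<open>r\<^sub>k\<^sub>+\<^sub>m\<close> is stochastically dominated by
  \<open>r\<^sub>k\<close> plus an independent copy of \<open>r\<^sub>m\<close>.\<close>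

lemma cprob_right_edge_ge_add:
  assumes p: "p \<in> {0..1}"
  shows "cprob p (right_edge_ge (k + m) a)
    \<le> (\<Sum>b\<in>{a - int m..int k}. cprob p (right_edge_eq k b) * cprob p (right_edge_ge m (a - b)))"
proof -
  define Q where "Q b c \<longleftrightarrow> right_edge_eq k b c \<and> right_edge_ge m (a - b) (pull ((+) (b, int k)) c)"
    for b c
  have eq: "local_on EE (right_edge_eq k b)" for b
    by (rule local_on_mono[OF local_on_right_edge_eq layer_subset_EE])
  have *: "local_on EE (Q b) \<and> cprob p (Q b) = cprob p (right_edge_eq k b) * cprob p (right_edge_ge m (a - b))"
    for b
  \<comment> \<open>For the wrong parity the translation by \<open>(b, k)\<close> is no symmetry of
    the lattice, but then \<open>r\<^sub>k = b\<close> is impossible and both sides vanish.\<close>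
  proof (cases "even (b + int k)")
    case True
    then have sym: "symmetry ((+) (b, int k))"
      by (intro symmetry_translate) (simp add: LL_def)
    have img: "image ((+) (b, int k)) ` layer 0 (int m) \<subseteq> layer (int k) (int k + int m)"
    proof
      fix e assume "e \<in> image ((+) (b, int k)) ` layer 0 (int m)"
      then obtain e' where e': "e = (+) (b, int k) ` e'" "e' \<in> EE" "snd ` e' \<subseteq> {0..int m}"
        unfolding layer_def by blast
      then show "e \<in> layer (int k) (int k + int m)"
        unfolding layer_def using symmetry_image_EE[OF sym] by fastforce
    qed
    have loc: "local_on (layer (int k) (int k + int m)) (\<lambda>c. right_edge_ge m (a - b) (pull ((+) (b, int k)) c))"
      using local_on_pull[OF sym local_on_right_edge_ge img] .
    have "local_on EE (Q b)"
      unfolding Q_def[abs_def]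
      by (intro local_on_conj eq local_on_mono[OF loc layer_subset_EE])
    moreover have "cprob p (Q b)
        = cprob p (right_edge_eq k b) * cprob p (\<lambda>c. right_edge_ge m (a - b) (pull ((+) (b, int k)) c))"
      unfolding Q_def[abs_def]
      by (rule cprob_indep[OF p local_on_right_edge_eq loc layer_subset_EE layer_subset_EE layer_disjoint])
    moreover have "cprob p (\<lambda>c. right_edge_ge m (a - b) (pull ((+) (b, int k)) c))
        = cprob p (right_edge_ge m (a - b))"
      by (rule cprob_pull[OF sym local_on_right_edge_ge p layer_subset_EE])
    ultimately show ?thesis by simp
  next
    case False
    then have no: "\<not> right_edge_eq k b c" for c
      unfolding right_edge_eq_def using reach_region[of half_line c k b] by (auto simp: half_line_def)
    then have "Q b = (\<lambda>_. False)" "right_edge_eq k b = (\<lambda>_. False)"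
      unfolding Q_def[abs_def] by auto
    then show ?thesis by (simp add: cprob_def)
  qed
  have "cprob p (right_edge_ge (k + m) a) \<le> cprob p (\<lambda>c. \<exists>b\<in>{a - int m..int k}. Q b c)"
  proof (rule cprob_mono[OF p])
    show "local_on EE (\<lambda>c. \<exists>b\<in>{a - int m..int k}. Q b c)"
      using * by (intro local_on_Bex) auto
    show "\<exists>b\<in>{a - int m..int k}. Q b c" if "right_edge_ge (k + m) a c" for c
      unfolding Q_def by (rule right_edge_ge_decompose[OF that])
  qed
  also have "\<dots> \<le> (\<Sum>b\<in>{a - int m..int k}. cprob p (Q b))"
    by (rule cprob_Bex_le[OF p]) (use * in auto)
  finally show ?thesis using * by simp
qed

text \<open>The mean of the truncated right edge \<open>max r\<^sub>k (-M)\<close>, written as a sum of tail probabilities.\<close>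

definition right_edge_mean :: "real \<Rightarrow> nat \<Rightarrow> nat \<Rightarrow> real" where
  "right_edge_mean p k M = - real M + (\<Sum>a\<in>{- int M<..int k}. cprob p (right_edge_ge k a))"

lemma local_on_EE_right_edge_ge: "local_on EE (right_edge_ge n a)"
  by (rule local_on_mono[OF local_on_right_edge_ge layer_subset_EE])

lemma local_on_EE_right_edge_eq: "local_on EE (right_edge_eq n a)"
  by (rule local_on_mono[OF local_on_right_edge_eq layer_subset_EE])

section \<open>Exponential moments and large deviations of the right edge\<close>

lemma has_bochner_integral_local_on:
  assumes "p \<in> {0..1}" "local_on EE Q"
  shows "has_bochner_integral (config_measure p) (\<lambda>c. of_bool (Q c) :: real) (cprob p Q)"
proof -
  interpret prob_space "config_measure p" by (rule prob_space_config_measure)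
  have "has_bochner_integral (config_measure p)
      (indicator {c \<in> space (config_measure p). Q c} :: config \<Rightarrow> real) (cprob p Q)"
    unfolding cprob_def using sets_local_on[OF assms] emeasure_finite
    by (intro has_bochner_integral_real_indicator) (auto simp: less_top[symmetric])
  then show ?thesis
    by (rule has_bochner_integral_cong[THEN iffD1, rotated -1]) (auto simp: indicator_def)
qed

text \<open>For negative \<open>x\<close> the product of \<open>1 + x + x\<^sup>2\<close> and
  \<open>1 - x\<close> is \<open>1 - x * x\<^sup>2\<close>, which is at least 1, while
  \<open>1 - x \<le> exp (- x)\<close>.\<close>

lemma exp_le_quadratic:
  fixes x :: real
  assumes "\<bar>x\<bar> \<le> 1"
  shows "exp x \<le> 1 + x + x\<^sup>2"
proof (cases "x \<ge> 0")
  case True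
  then show ?thesis using assms exp_bound[of x] by simp
next
  case False
  have "(1 + x + x\<^sup>2) * (1 - x) = 1 - x * x\<^sup>2"
    by (simp add: algebra_simps power2_eq_square)
  also have "\<dots> \<ge> 1"
    using False by (simp add: mult_nonpos_nonneg)
  finally have "1 \<le> (1 + x + x\<^sup>2) * (1 - x)" .
  also have "\<dots> \<le> (1 + x + x\<^sup>2) * exp (- x)"
    using exp_ge_add_one_self[of "- x"] assms False by (intro mult_left_mono) auto
  finally show ?thesis by (simp add: exp_minus field_simps)
qed

text \<open>With \<open>Z = max r\<^sub>k (-M)\<close>, the pointwise bounds \<open>exp (l *
  r\<^sub>k) \<le> exp (l * Z) \<le> 1 + l * Z + (l * Z)\<^sup>2\<close> are integrated. The cutoff
  \<open>B\<close> keeps the sum over the values of \<open>r\<^sub>k\<close> finite.\<close>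

lemma right_edge_exp_moment:
  fixes l :: real
  assumes p: "p \<in> {0..1}" and l: "l > 0" "l * (real k + real M) \<le> 1"
  shows "(\<Sum>b\<in>{B..int k}. cprob p (right_edge_eq k b) * exp (l * b))
    \<le> 1 + l * right_edge_mean p k M + (l * (real k + real M))\<^sup>2"
proof -
  interpret prob_space "config_measure p" by (rule prob_space_config_measure)
  define D where "D = real k + real M"
  \<comment> \<open>This counts the levels \<open>a > - M\<close> below or at
    \<open>r\<^sub>k\<close>, hence equals the truncated right edge; its mean is
    \<open>right_edge_mean p k M\<close>.\<close>
  define Z where "Z c = - real M + (\<Sum>a\<in>{- int M<..int k}. of_bool (right_edge_ge k a c))" for c
  have const: "has_bochner_integral (config_measure p) (\<lambda>_. x) x" for x :: real
    by (simp add: has_bochner_integral_iff prob_space)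
  have Z: "has_bochner_integral (config_measure p) Z (right_edge_mean p k M)"
    unfolding Z_def right_edge_mean_def
    by (intro has_bochner_integral_add has_bochner_integral_sum has_bochner_integral_local_on p
        local_on_EE_right_edge_ge const)
  have lhs: "has_bochner_integral (config_measure p)
      (\<lambda>c. \<Sum>b\<in>{B..int k}. of_bool (right_edge_eq k b c) * exp (l * b))
      (\<Sum>b\<in>{B..int k}. cprob p (right_edge_eq k b) * exp (l * b))"
    by (intro has_bochner_integral_sum has_bochner_integral_mult_left has_bochner_integral_local_on p
        local_on_EE_right_edge_eq)
  have rhs: "has_bochner_integral (config_measure p) (\<lambda>c. 1 + l * Z c + (l * D)\<^sup>2)
      (1 + l * right_edge_mean p k M + (l * D)\<^sup>2)"
    by (intro has_bochner_integral_add has_bochner_integral_mult_right Z)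
       (use const[of "1"] const[of "(l * D)\<^sup>2"] in auto)
  have Z_le: "Z c \<le> k" for c
  proof -
    have "(\<Sum>a\<in>{- int M<..int k}. of_bool (right_edge_ge k a c)) \<le> (\<Sum>a\<in>{- int M<..int k}. 1 :: real)"
      by (intro sum_mono) auto
    then show ?thesis unfolding Z_def by simp
  qed
  have Z_ge: "- real M \<le> Z c" for c
    unfolding Z_def by (simp add: sum_nonneg)
  have Z_abs: "\<bar>l * Z c\<bar> \<le> l * D" "l * D \<le> 1" for c
  proof -
    show "l * D \<le> 1" using l(2) unfolding D_def .
    have "\<bar>Z c\<bar> \<le> D" using Z_le[of c] Z_ge[of c] unfolding D_def by linarith
    then show "\<bar>l * Z c\<bar> \<le> l * D" using l(1) by (simp add: abs_mult)
  qed
  have pointwise: "(\<Sum>b\<in>{B..int k}. of_bool (right_edge_eq k b c) * exp (l * b)) \<le> 1 + l * Z c + (l * D)\<^sup>2"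
    for c
  proof (cases "\<exists>b\<in>{B..int k}. right_edge_eq k b c")
    case False
    then have "(\<Sum>b\<in>{B..int k}. of_bool (right_edge_eq k b c) * exp (l * b)) = 0"
      by (intro sum.neutral) auto
    moreover have "0 \<le> 1 + l * Z c" using Z_abs(1)[of c] Z_abs(2) by linarith
    ultimately show ?thesis by (metis add_nonneg_nonneg zero_le_power2)
  next
    case True
    then obtain b0 where b0: "b0 \<in> {B..int k}" "right_edge_eq k b0 c" by blast
    have "b = b0" if "right_edge_eq k b c" for b
    proof -
      have "\<not> b0 \<ge> b + 1" "\<not> b \<ge> b0 + 1"
        using that b0(2) unfolding right_edge_eq_def right_edge_ge_iff by blast+
      then show ?thesis by simp
    qed
    then have "(\<Sum>b\<in>{B..int k}. of_bool (right_edge_eq k b c) * exp (l * b))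
        = (\<Sum>b\<in>{b0}. of_bool (right_edge_eq k b c) * exp (l * b))"
      using b0(1) by (intro sum.mono_neutral_right) auto
    also have "\<dots> = exp (l * b0)" using b0 by simp
    also have "\<dots> \<le> exp (l * Z c)"
    proof -
      have "real_of_int b0 \<le> Z c"
      proof (cases "b0 > - int M")
        case True
        have "real_of_int b0 + real M = (\<Sum>a\<in>{- int M<..b0}. 1)"
          using True by simp
        also have "\<dots> = (\<Sum>a\<in>{- int M<..b0}. of_bool (right_edge_ge k a c))"
          using b0(2) unfolding right_edge_eq_def
          by (intro sum.cong) (auto simp: right_edge_ge_iff)
        also have "\<dots> \<le> (\<Sum>a\<in>{- int M<..int k}. of_bool (right_edge_ge k a c))"
          using b0(1) by (intro sum_mono2) auto
        finally show ?thesis unfolding Z_def by simp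
      next
        case False
        then have "real_of_int b0 \<le> - real M" by linarith
        then show ?thesis using Z_ge[of c] by simp
      qed
      then show ?thesis using l(1) by simp
    qed
    also have "\<dots> \<le> 1 + l * Z c + (l * Z c)\<^sup>2"
      using Z_abs(1)[of c] Z_abs(2) by (intro exp_le_quadratic) linarith
    also have "(l * Z c)\<^sup>2 \<le> (l * D)\<^sup>2"
      using Z_abs(1)[of c] by (simp add: abs_le_square_iff[symmetric])
    finally show ?thesis by simp
  qed
  have "(\<Sum>b\<in>{B..int k}. cprob p (right_edge_eq k b) * exp (l * b))
      = (\<integral>c. (\<Sum>b\<in>{B..int k}. of_bool (right_edge_eq k b c) * exp (l * b)) \<partial>config_measure p)"
    using lhs by (simp add: has_bochner_integral_iff)
  also have "\<dots> \<le> (\<integral>c. 1 + l * Z c + (l * D)\<^sup>2 \<partial>config_measure p)"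
    using lhs rhs pointwise by (intro integral_mono) (auto simp: has_bochner_integral_iff)
  also have "\<dots> = 1 + l * right_edge_mean p k M + (l * D)\<^sup>2"
    using rhs by (rule has_bochner_integral_integral_eq)
  finally show ?thesis unfolding D_def .
qed

text \<open>Exponential Markov inequality by induction on \<open>j\<close>: splitting off the first
  \<open>k\<close> levels costs a factor \<open>C\<close>, the bound on the exponential moment of
  one increment.\<close>

lemma right_edge_exp_bound:
  fixes l C :: real
  assumes p: "p \<in> {0..1}" and l: "l > 0"
    and C: "\<And>B. (\<Sum>b\<in>{B..int k}. cprob p (right_edge_eq k b) * exp (l * b)) \<le> C"
  shows "cprob p (right_edge_ge (j * k) a) \<le> C ^ j * exp (- l * a)"
proof (induction j arbitrary: a)
  case 0
  show ?case
  proof (cases "a \<le> 0")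
    case True
    then have "1 \<le> exp (- l * a)" using l by (simp add: mult_nonneg_nonpos)
    then show ?thesis by (intro order_trans[OF cprob_le_1]) simp
  next
    case False
    then have "right_edge_ge (0 * k) a = (\<lambda>_. False)"
      by (auto simp: right_edge_ge_def)
    then show ?thesis by (simp add: cprob_def)
  qed
next
  case (Suc j)
  have "0 \<le> (\<Sum>b\<in>{0..int k}. cprob p (right_edge_eq k b) * exp (l * b))"
    by (intro sum_nonneg) auto
  then have C0: "C \<ge> 0" using C[of 0] by linarith
  have "cprob p (right_edge_ge (Suc j * k) a)
      \<le> (\<Sum>b\<in>{a - int (j * k)..int k}. cprob p (right_edge_eq k b) * cprob p (right_edge_ge (j * k) (a - b)))"
    using cprob_right_edge_ge_add[OF p, of k "j * k" a] by simp
  also have "\<dots> \<le> (\<Sum>b\<in>{a - int (j * k)..int k}. cprob p (right_edge_eq k b) * (C ^ j * exp (- l * (a - b))))"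
    using Suc.IH by (intro sum_mono mult_left_mono) (simp_all del: of_int_diff)
  also have "\<dots> = C ^ j * exp (- l * a) * (\<Sum>b\<in>{a - int (j * k)..int k}. cprob p (right_edge_eq k b) * exp (l * b))"
    unfolding sum_distrib_left by (intro sum.cong refl) (simp add: exp_add[symmetric] algebra_simps)
  also have "\<dots> \<le> C ^ j * exp (- l * a) * C"
    using C0 by (intro mult_left_mono C) auto
  finally show ?case by (simp add: mult_ac)
qed

text \<open>Chernoff bound: the right edge is dominated by a random walk with the increments of \<open>r\<^sub>k\<close>.\<close>

lemma right_edge_large_deviation:
  fixes \<beta> \<delta> :: real
  assumes p: "p \<in> {0..1}" and k: "k > 0" and mean: "right_edge_mean p k M \<le> \<beta> * k" and \<delta>: "\<delta> > 0"
  obtains l :: real where "l > 0"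
    "\<And>j a. cprob p (right_edge_ge (j * k) a) \<le> exp (l * ((\<beta> + \<delta>) * real (j * k) - a))"
proof -
  define D where "D = real k + real M"
  have D: "D > 0" unfolding D_def using k by simp
  \<comment> \<open>The first bound gives \<open>l * D \<le> 1\<close>, as the moment estimate
    requires; the second makes the quadratic term \<open>(l * D)\<^sup>2\<close> at most
    \<open>l * \<delta> * k\<close>.\<close>
  define l where "l = min (1 / D) (\<delta> * k / D\<^sup>2)"
  have l: "l > 0" unfolding l_def using D k \<delta> by simp
  have "l \<le> 1 / D" "l \<le> \<delta> * k / D\<^sup>2" unfolding l_def by auto
  then have lD: "l * D \<le> 1" "l * D\<^sup>2 \<le> \<delta> * k"
    using D by (auto simp: field_simps)
  define C where "C = exp (l * (\<beta> + \<delta>) * k)"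
  have "(\<Sum>b\<in>{B..int k}. cprob p (right_edge_eq k b) * exp (l * b)) \<le> C" for B
  proof -
    have "(\<Sum>b\<in>{B..int k}. cprob p (right_edge_eq k b) * exp (l * b))
        \<le> 1 + l * right_edge_mean p k M + (l * D)\<^sup>2"
      unfolding D_def using lD(1) by (intro right_edge_exp_moment p l) (simp add: D_def)
    also have "\<dots> \<le> 1 + (l * (\<beta> * k) + l * (\<delta> * k))"
    proof -
      have "l * right_edge_mean p k M \<le> l * (\<beta> * k)"
        using mean l by (intro mult_left_mono) auto
      moreover have "l * (l * D\<^sup>2) \<le> l * (\<delta> * k)"
        using lD(2) l by (intro mult_left_mono) auto
      ultimately show ?thesis by (simp add: power2_eq_square mult_ac)
    qed
    also have "\<dots> = 1 + l * (\<beta> + \<delta>) * k"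
      by (simp add: algebra_simps)
    also have "\<dots> \<le> C" unfolding C_def by (rule exp_ge_add_one_self)
    finally show ?thesis .
  qed
  then have "cprob p (right_edge_ge (j * k) a) \<le> C ^ j * exp (- l * a)" for j a
    by (rule right_edge_exp_bound[OF p l])
  also have "C ^ j * exp (- l * a) = exp (l * ((\<beta> + \<delta>) * real (j * k) - a))" for j and a :: int
    unfolding C_def exp_of_nat_mult[symmetric] exp_add[symmetric] by (simp add: algebra_simps)
  finally show ?thesis using that l by blast
qed

section \<open>Percolation makes the right edge drift to the right\<close>

definition single_source :: "int \<Rightarrow> nat \<Rightarrow> bool" where
  "single_source x n \<longleftrightarrow> even (x + int n) \<and> (n = 0 \<longrightarrow> x = 0)"

definition survives :: "nat \<Rightarrow> config \<Rightarrow> bool" where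
  "survives n c \<longleftrightarrow> (\<exists>x\<in>{- int n..int n}. reach single_source c n x)"

lemma local_on_survives: "local_on EE (survives n)"
  unfolding survives_def[abs_def]
  by (intro local_on_Bex local_on_mono[OF local_on_reach] region_edges_subset_EE)
     (auto simp: single_source_def)

lemma reach_single_source_half_line:
  "reach single_source c n x \<Longrightarrow> reach half_line c n x"
  "reach single_source c n x \<Longrightarrow> reach half_line (pull reflect c) n (- x)"
proof -
  show "reach single_source c n x \<Longrightarrow> reach half_line c n x"
    by (induction n arbitrary: x) (auto simp: half_line_def single_source_def)
  show "reach single_source c n x \<Longrightarrow> reach half_line (pull reflect c) n (- x)"
  proof (induction n arbitrary: x)
    case (Suc n)
    from Suc.prems obtain z where z: "\<bar>z - x\<bar> = 1" "reach single_source c n z"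
      "c {(z, int n), (x, int n + 1)}"
      by force
    moreover have "half_line (- x) (Suc n)"
      using reach_region[OF Suc.prems] by (auto simp: half_line_def single_source_def)
    ultimately show ?case
      using Suc.IH[of z] by (intro reach_SucI[of _ _ _ "- z"]) (auto simp: pull_def reflect_def)
  qed (auto simp: half_line_def single_source_def)
qed

text \<open>The end point of a surviving path has a nonnegative abscissa, possibly after reflection.
  This is the form in which the left and right edges of a cluster cannot cross.\<close>

lemma survives_right_edge:
  assumes "survives n c"
  shows "right_edge_ge n 0 c \<or> right_edge_ge n 0 (pull reflect c)"
proof -
  obtain x where "reach single_source c n x"
    using assms unfolding survives_def by blast
  then show ?thesis
    using reach_single_source_half_line[of c n x] unfolding right_edge_ge_iff
    by (cases "x \<ge> 0") (auto intro: exI[of _ "- x"])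
qed

lemma local_on_right_edge_ge_reflect: "local_on EE (\<lambda>c. right_edge_ge n a (pull reflect c))"
  using local_on_pull[OF symmetry_reflect local_on_EE_right_edge_ge symmetry_image_EE[OF symmetry_reflect]] .

lemma cprob_survives_le:
  assumes p: "p \<in> {0..1}"
  shows "cprob p (survives n) \<le> 2 * cprob p (right_edge_ge n 0)"
proof -
  have "cprob p (survives n) \<le> cprob p (\<lambda>c. right_edge_ge n 0 c \<or> right_edge_ge n 0 (pull reflect c))"
    by (intro cprob_mono[OF p] local_on_disj local_on_EE_right_edge_ge local_on_right_edge_ge_reflect
        survives_right_edge)
  also have "\<dots> \<le> cprob p (right_edge_ge n 0) + cprob p (\<lambda>c. right_edge_ge n 0 (pull reflect c))"
    by (intro cprob_disj_le[OF p] local_on_EE_right_edge_ge local_on_right_edge_ge_reflect)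
  also have "cprob p (\<lambda>c. right_edge_ge n 0 (pull reflect c)) = cprob p (right_edge_ge n 0)"
    by (rule cprob_pull[OF symmetry_reflect local_on_EE_right_edge_ge p order_refl])
  finally show ?thesis by simp
qed

text \<open>Every edge changes the height, so a monotone path is strictly monotone. One half of it,
  read backwards if the path descends, is an infinite open upward path.\<close>

lemma infinite_vertical_open_path_survives:
  assumes "has_infinite_vertical_open_path c"
  shows "\<exists>z\<in>LL. \<forall>n. survives n (pull ((+) z) c)"
proof -
  obtain \<pi> where \<pi>: "infinite_path \<pi>" "vertical \<pi>" "open_path c \<pi>"
    using assms unfolding has_infinite_vertical_open_path_def by blast
  have adj: "adjacent (\<pi> i) (\<pi> (i + 1))" and op: "c {\<pi> i, \<pi> (i + 1)}" for i
    using \<pi> unfolding infinite_path_def open_path_def cost_def by auto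
  have step: "\<bar>snd (\<pi> (i + 1)) - snd (\<pi> i)\<bar> = 1" for i
    using adj[of i] by (cases "\<pi> i"; cases "\<pi> (i + 1)") (auto simp: adjacent_iff)
  have "\<exists>\<rho> :: nat \<Rightarrow> vertex. \<forall>n. adjacent (\<rho> n) (\<rho> (Suc n)) \<and> c {\<rho> n, \<rho> (Suc n)} \<and>
      snd (\<rho> (Suc n)) = snd (\<rho> n) + 1"
  proof (cases "mono (\<lambda>i. snd (\<pi> i))")
    case True
    have inc: "snd (\<pi> (i + 1)) = snd (\<pi> i) + 1" for i
      using monoD[OF True, of i "i + 1"] step[of i] by simp
    have "adjacent (\<pi> (int n)) (\<pi> (int (Suc n))) \<and> c {\<pi> (int n), \<pi> (int (Suc n))} \<and>
      snd (\<pi> (int (Suc n))) = snd (\<pi> (int n)) + 1" for n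
      using adj[of "int n"] op[of "int n"] inc[of "int n"] by (simp add: add.commute)
    then show ?thesis by (intro exI[of _ "\<lambda>n. \<pi> (int n)"]) auto
  next
    case False
    then have anti: "antimono (\<lambda>i. snd (\<pi> i))" using \<pi>(2) unfolding vertical_def by blast
    have dec: "snd (\<pi> i) = snd (\<pi> (i + 1)) + 1" for i
      using antimonoD[OF anti, of i "i + 1"] step[of i] by simp
    have "adjacent (\<pi> (- int n)) (\<pi> (- int (Suc n))) \<and> c {\<pi> (- int n), \<pi> (- int (Suc n))} \<and>
      snd (\<pi> (- int (Suc n))) = snd (\<pi> (- int n)) + 1" for n
      using adj[of "- int (Suc n)"] op[of "- int (Suc n)"] dec[of "- int (Suc n)"]
      by (simp add: insert_commute adjacent_commute)
    then show ?thesis by (intro exI[of _ "\<lambda>n. \<pi> (- int n)"]) auto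
  qed
  then obtain \<rho> :: "nat \<Rightarrow> vertex" where \<rho>: "\<And>n. adjacent (\<rho> n) (\<rho> (Suc n))"
    "\<And>n. c {\<rho> n, \<rho> (Suc n)}" "\<And>n. snd (\<rho> (Suc n)) = snd (\<rho> n) + 1"
    by blast
  obtain a b where ab: "\<rho> 0 = (a, b)" by (cases "\<rho> 0")
  have ev: "even (a + b)" using \<rho>(1)[of 0] ab by (cases "\<rho> (Suc 0)") (auto simp: adjacent_iff)
  have snd: "snd (\<rho> n) = b + int n" for n
    by (induction n) (auto simp: ab \<rho>(3))
  have x: "\<bar>fst (\<rho> (Suc n)) - fst (\<rho> n)\<bar> = 1 \<and> even (fst (\<rho> n) + snd (\<rho> n))" for n
    using \<rho>(1)[of n] by (cases "\<rho> n"; cases "\<rho> (Suc n)") (auto simp: adjacent_iff)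
  have "reach single_source (pull ((+) (a, b)) c) n (fst (\<rho> n) - a)" for n
  proof (rule path_reach[of n _ "\<lambda>n. fst (\<rho> n) - a"])
    show "single_source (fst (\<rho> m) - a) m" if "m \<le> n" for m
      using x[of m] ev ab unfolding single_source_def snd by (auto simp: algebra_simps)
    show "\<bar>fst (\<rho> (Suc m)) - a - (fst (\<rho> m) - a)\<bar> = 1 \<and>
        pull ((+) (a, b)) c {(fst (\<rho> m) - a, int m), (fst (\<rho> (Suc m)) - a, int m + 1)}" for m
    proof -
      have "\<rho> m = (fst (\<rho> m), b + int m)" "\<rho> (Suc m) = (fst (\<rho> (Suc m)), b + (int m + 1))"
        using snd[of m] snd[of "Suc m"] by (auto simp: prod_eq_iff)
      then have "c {(fst (\<rho> m), b + int m), (fst (\<rho> (Suc m)), b + (int m + 1))}"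
        using \<rho>(2)[of m] by simp
      then show ?thesis using x[of m] by (simp add: pull_translate_edge)
    qed
  qed
  moreover have bound: "\<bar>fst (\<rho> n) - a\<bar> \<le> int n" for n
  proof (induction n)
    case (Suc n)
    moreover have "\<bar>fst (\<rho> (Suc n)) - fst (\<rho> n)\<bar> = 1" using x[of n] by blast
    ultimately show ?case by simp
  qed (simp add: ab)
  moreover have "fst (\<rho> n) - a \<in> {- int n..int n}" for n
    using bound[of n] unfolding atLeastAtMost_iff by linarith
  ultimately have "survives n (pull ((+) (a, b)) c)" for n
    unfolding survives_def by blast
  then show ?thesis using ev by (intro bexI[of _ "(a, b)"]) (auto simp: LL_def)
qed

text \<open>A negative mean would make survival up to height \<open>j * k\<close> exponentially
  unlikely. Then almost surely no lattice point, of which there are countably many, starts an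
  infinite upward open path.\<close>

lemma right_edge_mean_nonneg_supercritical:
  assumes p: "p \<in> {0..1}" and perc: "AE c in config_measure p. has_infinite_vertical_open_path c"
    and k: "k > 0"
  shows "right_edge_mean p k M \<ge> 0"
proof (rule ccontr)
  interpret prob_space "config_measure p" by (rule prob_space_config_measure)
  assume neg: "\<not> right_edge_mean p k M \<ge> 0"
  define \<beta> where "\<beta> = right_edge_mean p k M / k"
  have \<beta>: "\<beta> < 0" "right_edge_mean p k M \<le> \<beta> * k"
    unfolding \<beta>_def using neg k by (auto simp: divide_neg_pos)
  \<comment> \<open>With slack \<open>- \<beta> / 2\<close> the exponential rate is still governed
    by the negative slope \<open>\<beta> / 2\<close>.\<close>
  obtain l where l: "l > 0"
    "\<And>j a. cprob p (right_edge_ge (j * k) a) \<le> exp (l * ((\<beta> + (- \<beta> / 2)) * real (j * k) - a))"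
    using right_edge_large_deviation[OF p k \<beta>(2), of "- \<beta> / 2"] \<beta>(1) by auto
  define r where "r = exp (l * (\<beta> / 2) * k)"
  have r: "0 \<le> r" "r < 1"
    unfolding r_def using l \<beta>(1) k by (auto simp: mult_pos_neg mult_neg_pos)
  have surv: "cprob p (survives (j * k)) \<le> 2 * r ^ j" for j
  proof -
    have "cprob p (survives (j * k)) \<le> 2 * cprob p (right_edge_ge (j * k) 0)"
      by (rule cprob_survives_le[OF p])
    also have "cprob p (right_edge_ge (j * k) 0) \<le> r ^ j"
      using l(2)[of j 0] unfolding r_def exp_of_nat_mult[symmetric] by (simp add: mult_ac)
    finally show ?thesis by simp
  qed
  have "AE c in config_measure p. \<not> (\<forall>n. survives n (pull ((+) z) c))" if z: "z \<in> LL" for z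
  proof -
    define N where "N = {c \<in> space (config_measure p). \<forall>n. survives n (pull ((+) z) c)}"
    have loc: "local_on EE (\<lambda>c. survives n (pull ((+) z) c))" for n
      by (rule local_on_pull[OF symmetry_translate[OF z] local_on_survives
            symmetry_image_EE[OF symmetry_translate[OF z]]])
    have N: "N \<in> events"
      unfolding N_def by (intro sets.sets_Collect_countable_All sets_local_on[OF p] loc)
    have "prob N \<le> 2 * r ^ j" for j
    proof -
      have "prob N \<le> cprob p (\<lambda>c. survives (j * k) (pull ((+) z) c))"
        unfolding N_def cprob_def
        by (intro finite_measure_mono sets_local_on[OF p] loc) auto
      also have "\<dots> = cprob p (survives (j * k))"
        by (rule cprob_pull[OF symmetry_translate[OF z] local_on_survives p order_refl])
      finally show ?thesis using surv[of j] by simp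
    qed
    moreover have "(\<lambda>j. 2 * r ^ j) \<longlonglongrightarrow> 2 * 0"
      using r by (intro tendsto_mult tendsto_const LIMSEQ_power_zero) auto
    ultimately have "prob N \<le> 0"
      by (intro LIMSEQ_le_const[of "\<lambda>j. 2 * r ^ j" 0]) auto
    then have "prob N = 0" by (simp add: measure_le_0_iff)
    then show ?thesis
      using N AE_iff_measurable[of N "config_measure p" "\<lambda>c. \<not> (\<forall>n. survives n (pull ((+) z) c))"]
      unfolding N_def by (auto simp: emeasure_eq_measure)
  qed
  then have "AE c in config_measure p. \<forall>z\<in>LL. \<not> (\<forall>n. survives n (pull ((+) z) c))"
    by (subst AE_ball_countable) auto
  then have "AE c in config_measure p. False"
    using perc by eventually_elim (use infinite_vertical_open_path_survives in blast)
  then show False by simp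
qed

lemma continuous_on_right_edge_mean: "continuous_on {0..1} (\<lambda>p. right_edge_mean p k M)"
  unfolding right_edge_mean_def
  by (intro continuous_intros continuous_on_cprob local_on_EE_right_edge_ge)

text \<open>For fixed \<open>k\<close> and \<open>M\<close> the mean is continuous in
  \<open>p\<close>, so its sign survives the limit from the right.\<close>

lemma right_edge_mean_nonneg_critical:
  assumes pc: "is_critical_parameter pc" and k: "k > 0"
  shows "right_edge_mean pc k M \<ge> 0"
proof (rule tendsto_lowerbound)
  have pc01: "0 < pc" "pc < 1" using pc unfolding is_critical_parameter_def by auto
  have "continuous_on {pc..1} (\<lambda>p. right_edge_mean p k M)"
    by (rule continuous_on_subset[OF continuous_on_right_edge_mean]) (use pc01 in auto)
  then have "((\<lambda>p. right_edge_mean p k M) \<longlongrightarrow> right_edge_mean pc k M) (at pc within {pc..1})"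
    using pc01 unfolding continuous_on_def by auto
  then show "((\<lambda>p. right_edge_mean p k M) \<longlongrightarrow> right_edge_mean pc k M) (at_right pc)"
    using at_within_Icc_at_right[OF pc01(2)] by simp
  show "\<forall>\<^sub>F p in at_right pc. 0 \<le> right_edge_mean p k M"
    unfolding eventually_at_right[OF pc01(2)]
    using right_edge_mean_nonneg_supercritical[OF _ _ k] pc pc01
    unfolding is_critical_parameter_def
    by (intro exI[of _ 1]) (auto intro!: right_edge_mean_nonneg_supercritical[OF _ _ k])
qed simp

section \<open>Straight open paths at the critical parameter\<close>

lemma cprob_edge:
  assumes "p \<in> {0..1}" "e \<in> EE"
  shows "cprob p (\<lambda>c. c e) = p"
proof -
  have "cprob p (\<lambda>c. c e) = (\<Sum>S\<in>Pow {e}. of_bool (e \<in> S) * weight p {e} S)"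
    by (rule cprob_depends_on) (use assms in \<open>auto simp: depends_on_def\<close>)
  also have "Pow {e} = {{}, {e}}" by auto
  finally show ?thesis by (simp add: weight_def)
qed

text \<open>From the half-line, \<open>(1, 1)\<close> can be reached only through the edge at the
  origin. This yields \<open>speed < 1\<close>, without which moving right would not cross a
  strip.\<close>

lemma right_edge_mean_1_0:
  assumes p: "p \<in> {0..1}"
  shows "right_edge_mean p 1 0 \<le> p"
proof -
  have "{- int 0<..int 1} = {1}" by auto
  then have "right_edge_mean p 1 0 = cprob p (right_edge_ge 1 1)"
    by (simp add: right_edge_mean_def)
  also have "\<dots> \<le> cprob p (\<lambda>c. c {(0, 0), (1, 1)})"
  proof (rule cprob_mono[OF p])
    show "local_on EE (\<lambda>c. c {(0, 0), (1, 1)})"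
      by (rule local_on_edge) (simp add: edge_in_EE adjacent_iff)
    show "c {(0, 0), (1, 1)}" if "right_edge_ge 1 1 c" for c
      using that by (auto simp: right_edge_ge_def half_line_def)
  qed
  also have "\<dots> = p"
    by (rule cprob_edge[OF p]) (simp add: edge_in_EE adjacent_iff)
  finally show ?thesis .
qed

section \<open>Confinement of open paths to a tube\<close>

lemma right_edge_ge_mono: "right_edge_ge n b c \<Longrightarrow> a \<le> b \<Longrightarrow> right_edge_ge n a c"
  unfolding right_edge_ge_iff by (meson order_trans)

lemma right_edge_ge_ancestor:
  assumes "right_edge_ge (k + m) a c"
  shows "right_edge_ge k (a - int m) c"
proof -
  obtain x where "x \<ge> a" "reach half_line c (k + m) x"
    using assms unfolding right_edge_ge_iff by blast
  with reach_half_line_ancestor[of c k m x] obtain x' where "x' \<ge> x - int m" "reach half_line c k x'"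
    by blast
  with \<open>x \<ge> a\<close> show ?thesis unfolding right_edge_ge_iff by (intro exI[of _ x']) simp
qed

text \<open>The floor plus 1 is the least integer strictly to the right of the line
  \<open>x = \<alpha> * m + K\<close>.\<close>

definition stays_below :: "real \<Rightarrow> real \<Rightarrow> nat \<Rightarrow> config \<Rightarrow> bool" where
  "stays_below \<alpha> K n c \<longleftrightarrow> (\<forall>m\<in>{..n}. \<not> right_edge_ge m (\<lfloor>\<alpha> * m + K\<rfloor> + 1) c)"

lemma local_on_stays_below: "local_on EE (stays_below \<alpha> K n)"
  unfolding stays_below_def[abs_def]
  by (intro local_on_Ball local_on_not local_on_EE_right_edge_ge) auto

lemma stays_belowD:
  assumes "stays_below \<alpha> K n c" "m \<le> n" "reach half_line c m x"
  shows "x \<le> \<alpha> * m + K"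
proof -
  have "\<not> x \<ge> \<lfloor>\<alpha> * m + K\<rfloor> + 1"
    using assms unfolding stays_below_def right_edge_ge_iff by auto
  then show ?thesis by linarith
qed

definition tube :: "real \<Rightarrow> real \<Rightarrow> int \<Rightarrow> nat \<Rightarrow> bool" where
  "tube \<alpha> K x m \<longleftrightarrow> even (x + int m) \<and> \<bar>x - \<alpha> * m\<bar> \<le> K"

definition tube_crossed :: "real \<Rightarrow> real \<Rightarrow> nat \<Rightarrow> config \<Rightarrow> bool" where
  "tube_crossed \<alpha> K n c \<longleftrightarrow> (\<exists>x\<in>{\<lfloor>\<alpha> * n - K\<rfloor>..\<lceil>\<alpha> * n + K\<rceil>}. reach (tube \<alpha> K) c n x)"

lemma tube_crossed_iff: "tube_crossed \<alpha> K n c \<longleftrightarrow> (\<exists>x. reach (tube \<alpha> K) c n x)"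
proof -
  have "x \<in> {\<lfloor>\<alpha> * n - K\<rfloor>..\<lceil>\<alpha> * n + K\<rceil>}" if "reach (tube \<alpha> K) c n x" for x
    using reach_region[OF that] unfolding tube_def by (auto simp: abs_le_iff) linarith+
  then show ?thesis unfolding tube_crossed_def by blast
qed

lemma local_on_tube_crossed: "local_on (region_edges (tube \<alpha> K) n) (tube_crossed \<alpha> K n)"
  unfolding tube_crossed_def[abs_def] by (intro local_on_Bex local_on_reach) auto

lemma tube_edges_subset_EE: "region_edges (tube \<alpha> K) n \<subseteq> EE"
  by (rule region_edges_subset_EE) (simp add: tube_def)

text \<open>A path that ends far to the right cannot have strayed to the left before: seen from its end
  point, with the plane rotated by a half turn, it would overtake the right edge.\<close>

lemma tube_crossedI:
  assumes ge: "right_edge_ge n X c" and below: "stays_below \<alpha> K n c"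
    and turned: "stays_below \<alpha> K n (pull (rotate_about (X, int n)) c)"
    and X: "even (X + int n)" "X \<ge> \<alpha> * n - K'" and K': "K' \<ge> 0"
  shows "tube_crossed \<alpha> (K + K') n c"
proof -
  obtain x where x: "x \<ge> X" "reach half_line c n x"
    using ge unfolding right_edge_ge_iff by blast
  obtain f where f: "f n = x" "\<And>m. m \<le> n \<Longrightarrow> half_line (f m) m \<and> reach half_line c m (f m)"
    "\<And>m. m < n \<Longrightarrow> \<bar>f (Suc m) - f m\<bar> = 1 \<and> c {(f m, int m), (f (Suc m), int m + 1)}"
    using reach_path[OF x(2)] by blast
  \<comment> \<open>The path \<open>f\<close> read backwards after the half turn that sends
    \<open>(X, n)\<close> to the origin. It starts at \<open>X - x \<le> 0\<close>, hence in the
    half-line.\<close>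
  define g where "g m = X - f (n - m)" for m
  have g_half: "half_line (g m) m" if "m \<le> n" for m
  proof -
    have "even (f (n - m) + int (n - m))" using f(2)[of "n - m"] unfolding half_line_def by simp
    then have "even (g m + int m)"
      using X(1) that unfolding g_def by (auto simp: of_nat_diff)
    moreover have "g 0 \<le> 0" unfolding g_def using f(1) x(1) by simp
    ultimately show ?thesis unfolding half_line_def by auto
  qed
  have g_reach: "reach half_line (pull (rotate_about (X, int n)) c) m (g m)" if "m \<le> n" for m
  proof (rule path_reach[of m half_line g])
    fix i assume i: "i < m"
    define j where "j = n - Suc i"
    have j: "n - i = Suc j" "j < n" "int n - int i = int j + 1" "int n - (int i + 1) = int j"
      unfolding j_def using i that by auto
    have "rotate_about (X, int n) (g i, int i) = (f (Suc j), int j + 1)"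
      unfolding rotate_about_def g_def using j(1,3) by simp
    moreover have "rotate_about (X, int n) (g (Suc i), int i + 1) = (f j, int j)"
      unfolding rotate_about_def g_def using j(4) by (simp add: j_def[symmetric])
    ultimately have "pull (rotate_about (X, int n)) c {(g i, int i), (g (Suc i), int i + 1)}
        = c {(f (Suc j), int j + 1), (f j, int j)}"
      unfolding pull_def by simp
    also have "\<dots>" using f(3)[OF j(2)] by (simp add: insert_commute)
    finally show "\<bar>g (Suc i) - g i\<bar> = 1 \<and>
        pull (rotate_about (X, int n)) c {(g i, int i), (g (Suc i), int i + 1)}"
      using f(3)[OF j(2)] unfolding g_def j(1) by (simp add: j_def[symmetric])
  qed (use g_half that in auto)
  have "tube \<alpha> (K + K') (f m) m" if m: "m \<le> n" for m
  proof -
    have 1: "f m \<le> \<alpha> * m + K"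
      using stays_belowD[OF below m] f(2)[OF m] by blast
    \<comment> \<open>The right edge of the rotated picture bounds the reversed path from the right,
      which bounds \<open>f\<close> from the left.\<close>
    have "X - f m \<le> \<alpha> * real (n - m) + K"
      using stays_belowD[OF turned _ g_reach[of "n - m"]] m unfolding g_def by simp
    then have 2: "f m \<ge> \<alpha> * m - K - K'"
      using X(2) m by (simp add: of_nat_diff algebra_simps)
    show ?thesis
      using 1 2 K' f(2)[OF m] unfolding tube_def half_line_def by (auto simp: abs_le_iff)
  qed
  then have "reach (tube \<alpha> (K + K')) c n (f n)"
    using f(3) by (intro path_reach) auto
  then show ?thesis unfolding tube_crossed_iff by blast
qed

section \<open>Concentration of the right edge around its speed\<close>

locale nonneg_drift =
  fixes p :: real
  assumes p: "0 < p" "p < 1"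
    and drift: "\<And>k M. k > 0 \<Longrightarrow> right_edge_mean p k M \<ge> 0"
begin

text \<open>The infimum runs over all heights and all truncations at once. It is the slope around
  which \<open>r\<^sub>n / n\<close> is shown to concentrate.\<close>

definition speed :: real where
  "speed = Inf {right_edge_mean p k M / k |k M. k > 0}"

lemma p01: "p \<in> {0..1}"
  using p by simp

lemma bdd_below_means: "bdd_below {right_edge_mean p k M / k |k M. k > 0}"
  by (intro bdd_belowI[of _ 0]) (auto simp: drift)

lemma speed_le: "k > 0 \<Longrightarrow> speed * k \<le> right_edge_mean p k M"
proof -
  assume k: "k > 0"
  then have "right_edge_mean p k M / k \<in> {right_edge_mean p k M / k |k M. k > 0}" by blast
  from cInf_lower[OF this bdd_below_means] show ?thesis
    unfolding speed_def[symmetric] using k by (simp add: field_simps)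
qed

lemma speed_nonneg: "speed \<ge> 0"
  unfolding speed_def by (intro cInf_greatest) (auto simp: drift intro: exI[of _ 1])

lemma speed_less_1: "speed < 1"
  using speed_le[of 1 0] right_edge_mean_1_0[OF p01] p by simp

text \<open>Some truncated mean has slope below \<open>speed + s / 4\<close>; the Chernoff bound
  with slack \<open>s / 4\<close> leaves a margin \<open>s / 2 * n\<close> at each height, and a
  union bound over the \<open>n + 1\<close> heights follows.\<close>

lemma not_stays_below_le:
  fixes s :: real
  assumes s: "s > 0"
  obtains l k where "l > 0" "\<And>n. cprob p (\<lambda>c. \<not> stays_below speed (s * n) n c)
    \<le> (real n + 1) * exp (l * (real k - s / 2 * n))"
proof -
  obtain k M where k: "k > 0" "right_edge_mean p k M / k < speed + s / 4"
  proof -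
    have "\<exists>x\<in>{right_edge_mean p k M / k |k M. k > 0}. x < speed + s / 4"
      unfolding speed_def using s by (intro cInf_lessD) (auto intro: exI[of _ 1])
    then show ?thesis using that by blast
  qed
  then have "right_edge_mean p k M \<le> (speed + s / 4) * k"
    by (simp add: field_simps)
  from right_edge_large_deviation[OF p01 k(1) this, of "s / 4"] s
  obtain l where l: "l > 0" "\<And>j a. cprob p (right_edge_ge (j * k) a)
      \<le> exp (l * ((speed + s / 4 + s / 4) * real (j * k) - a))"
    by auto
  have one: "cprob p (right_edge_ge m (\<lfloor>speed * m + s * n\<rfloor> + 1)) \<le> exp (l * (real k - s / 2 * n))"
    if "m \<le> n" for m n
  proof -
    define a where "a = \<lfloor>speed * m + s * n\<rfloor> + 1"
    \<comment> \<open>The Chernoff bound covers only multiples of \<open>k\<close>; descending the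
      remaining \<open>i < k\<close> levels costs at most \<open>i\<close> in position, hence the
      term \<open>real k\<close>.\<close>
    define j where "j = m div k"
    define i where "i = m mod k"
    have m: "m = j * k + i" "i < k"
      unfolding j_def i_def using k(1) by auto
    have "cprob p (right_edge_ge m a) \<le> cprob p (right_edge_ge (j * k) (a - int i))"
      unfolding m(1)
      by (intro cprob_mono[OF p01 local_on_EE_right_edge_ge] right_edge_ge_ancestor)
    also have "\<dots> \<le> exp (l * ((speed + s / 4 + s / 4) * real (j * k) - (a - int i)))"
      using l(2)[of j "a - int i"] by simp
    also have "\<dots> \<le> exp (l * (real k - s / 2 * n))"
    proof -
      have "real (j * k) \<le> real m" using m by simp
      then have "(speed + s / 2) * real (j * k) \<le> (speed + s / 2) * m"
        using speed_nonneg s by (intro mult_left_mono) auto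
      also have "\<dots> \<le> speed * m + s / 2 * n"
        using that s by (simp add: algebra_simps)
      finally have "(speed + s / 2) * real (j * k) \<le> speed * m + s / 2 * n" .
      moreover have "real_of_int a \<ge> speed * m + s * n"
        unfolding a_def by linarith
      ultimately have "(speed + s / 4 + s / 4) * real (j * k) - (a - int i) \<le> real k - s / 2 * n"
        using m(2) by (simp add: algebra_simps)
      then show ?thesis using l(1) by simp
    qed
    finally show ?thesis unfolding a_def .
  qed
  have "cprob p (\<lambda>c. \<not> stays_below speed (s * n) n c) \<le> (real n + 1) * exp (l * (real k - s / 2 * n))" for n
  proof -
    have "(\<lambda>c. \<not> stays_below speed (s * n) n c)
        = (\<lambda>c. \<exists>m\<in>{..n}. right_edge_ge m (\<lfloor>speed * m + s * n\<rfloor> + 1) c)"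
      unfolding stays_below_def by blast
    then have "cprob p (\<lambda>c. \<not> stays_below speed (s * n) n c)
        \<le> (\<Sum>m\<in>{..n}. cprob p (right_edge_ge m (\<lfloor>speed * m + s * n\<rfloor> + 1)))"
      using cprob_Bex_le[OF p01, of "{..n}" "\<lambda>m. right_edge_ge m (\<lfloor>speed * m + s * n\<rfloor> + 1)"]
      by (simp add: local_on_EE_right_edge_ge)
    also have "\<dots> \<le> (\<Sum>m\<in>{..n}. exp (l * (real k - s / 2 * n)))"
      using one by (intro sum_mono) auto
    finally show ?thesis by (simp add: add.commute)
  qed
  then show ?thesis using that l(1) by blast
qed

lemma stays_below_eventually:
  assumes "s > 0" "\<eta> > 0"
  shows "\<forall>\<^sub>F n in sequentially. cprob p (\<lambda>c. \<not> stays_below speed (s * real n) n c) < \<eta>"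
proof -
  obtain l k where l: "l > 0" "\<And>n. cprob p (\<lambda>c. \<not> stays_below speed (s * n) n c)
      \<le> (real n + 1) * exp (l * (real k - s / 2 * n))"
    using not_stays_below_le[OF assms(1)] by blast
  define r where "r = exp (- l * s / 2)"
  have r: "norm r < 1" unfolding r_def using l(1) assms(1) by simp
  have eq: "(real n + 1) * exp (l * (real k - s / 2 * n)) = exp (l * k) * (real n * r ^ n + r ^ n)" for n
  proof -
    have "exp (l * (real k - s / 2 * n)) = exp (l * k) * r ^ n"
      unfolding r_def exp_of_nat_mult[symmetric] exp_add[symmetric] by (simp add: algebra_simps)
    then show ?thesis by (simp add: algebra_simps)
  qed
  have "(\<lambda>n. exp (l * k) * (real n * r ^ n + r ^ n)) \<longlonglongrightarrow> exp (l * k) * (0 + 0)"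
    using r by (intro tendsto_intros powser_times_n_limit_0 LIMSEQ_power_zero) auto
  then have "\<forall>\<^sub>F n in sequentially. exp (l * k) * (real n * r ^ n + r ^ n) < \<eta>"
    using assms(2) by (intro order_tendstoD(2)) auto
  then show ?thesis
  proof eventually_elim
    case (elim n)
    then show ?case using l(2)[of n] eq[of n] by linarith
  qed
qed

text \<open>The mean of the truncated right edge is at least \<open>speed * n\<close>, while it
  hardly ever exceeds \<open>(speed + \<delta>) * n\<close>. So it cannot fall short by
  \<open>s * n\<close> with probability \<open>\<eta>\<close>.\<close>

lemma right_edge_ge_eventually:
  assumes s: "0 < s" "s \<le> 1" and \<eta>: "\<eta> > 0"
  shows "\<forall>\<^sub>F n in sequentially. \<forall>a. real_of_int a \<le> (speed - s) * real n \<and> a \<ge> - int n \<longrightarrow>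
    cprob p (right_edge_ge n a) > 1 - \<eta>"
proof -
  \<comment> \<open>A shortfall costs the mean \<open>\<eta> * s * n = 4 * \<delta> * n\<close>,
    whereas the errors add up to \<open>2 * \<delta> * n + 1 < 3 * \<delta> * n\<close>.\<close>
  define \<delta> where "\<delta> = \<eta> * s / 4"
  have \<delta>: "\<delta> > 0" unfolding \<delta>_def using s \<eta> by simp
  have "\<forall>\<^sub>F n in sequentially. cprob p (\<lambda>c. \<not> stays_below speed (\<delta> * real n) n c) < \<delta> / 2"
    using \<delta> by (intro stays_below_eventually) auto
  moreover have "\<forall>\<^sub>F n in sequentially. real n > 1 / \<delta>"
    using filterlim_real_sequentially unfolding filterlim_at_top_dense by blast
  ultimately show ?thesis
  proof eventually_elim
    fix n assume below: "cprob p (\<lambda>c. \<not> stays_below speed (\<delta> * real n) n c) < \<delta> / 2"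
      and n: "real n > 1 / \<delta>"
    have n0: "n > 0" using n \<delta> by (cases n) auto
    have n1: "1 < \<delta> * n" using n \<delta> by (simp add: field_simps)
    show "\<forall>a. real_of_int a \<le> (speed - s) * real n \<and> a \<ge> - int n \<longrightarrow> cprob p (right_edge_ge n a) > 1 - \<eta>"
    proof (intro allI impI)
      fix a :: int assume a: "real_of_int a \<le> (speed - s) * real n \<and> a \<ge> - int n"
      define q where "q = cprob p (right_edge_ge n a)"
      define u where "u = \<lfloor>speed * n + \<delta> * n\<rfloor>"
      have u: "real_of_int u \<le> speed * n + \<delta> * n" "speed * n + \<delta> * n < real_of_int u + 1"
        unfolding u_def by linarith+
      have "real_of_int a < real_of_int u + 1"
        using a u(2) mult_pos_pos[OF s(1), of n] \<delta> n0 n1 by (simp add: algebra_simps)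
      then have au: "a \<le> u" by linarith
      have top: "cprob p (right_edge_ge n b) \<le> \<delta> / 2" if "b > u" for b
      proof -
        have "cprob p (right_edge_ge n b) \<le> cprob p (\<lambda>c. \<not> stays_below speed (\<delta> * real n) n c)"
        proof (rule cprob_mono[OF p01 local_on_not[OF local_on_stays_below]])
          fix c assume "right_edge_ge n b c"
          then have "right_edge_ge n (u + 1) c"
            using that by (auto elim: right_edge_ge_mono)
          then show "\<not> stays_below speed (\<delta> * real n) n c"
            unfolding stays_below_def u_def by auto
        qed
        then show ?thesis using below by simp
      qed
      have mid: "cprob p (right_edge_ge n b) \<le> q" if "b \<ge> a" for b
        unfolding q_def using that
        by (intro cprob_mono[OF p01 local_on_EE_right_edge_ge]) (auto elim: right_edge_ge_mono)
      \<comment> \<open>Tail probabilities are bounded by 1 below \<open>a\<close>, by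
        \<open>q\<close> between \<open>a\<close> and \<open>u\<close>, and by
        \<open>\<delta> / 2\<close> above \<open>u\<close>.\<close>
      have pointwise: "cprob p (right_edge_ge n b) \<le> of_bool (b < a) + of_bool (a \<le> b \<and> b \<le> u) * q + \<delta> / 2"
        for b
      proof -
        consider "b < a" | "a \<le> b" "b \<le> u" | "b > u" by linarith
        then show ?thesis
        proof cases
          case 1
          then show ?thesis using cprob_le_1[of p "right_edge_ge n b"] \<delta> by (simp del: cprob_le_1)
        next
          case 2
          then show ?thesis using mid[of b] \<delta> by simp
        next
          case 3
          then show ?thesis using top[of b] au by simp
        qed
      qed
      have "(\<Sum>b\<in>{- int n<..int n}. cprob p (right_edge_ge n b))
          \<le> (\<Sum>b\<in>{- int n<..int n}. of_bool (b < a) + of_bool (a \<le> b \<and> b \<le> u) * q + \<delta> / 2)"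
        by (intro sum_mono pointwise)
      also have "\<dots> = (\<Sum>b\<in>{- int n<..int n}. of_bool (b < a))
          + (\<Sum>b\<in>{- int n<..int n}. of_bool (a \<le> b \<and> b \<le> u)) * q + n * \<delta>"
        by (simp add: sum.distrib sum_distrib_right)
      also have "(\<Sum>b\<in>{- int n<..int n}. of_bool (b < a)) \<le> real_of_int a + n"
      proof -
        have "(\<Sum>b\<in>{- int n<..int n}. of_bool (b < a) :: real) = card ({- int n<..int n} \<inter> {b. b < a})"
          by (simp add: sum_of_bool_eq)
        also have "\<dots> \<le> real (card {- int n..<a})"
          by (intro of_nat_mono card_mono) auto
        also have "\<dots> = real_of_int a + n" using a by simp
        finally show ?thesis .
      qed
      also have "(\<Sum>b\<in>{- int n<..int n}. of_bool (a \<le> b \<and> b \<le> u)) * q \<le> (real_of_int u - a + 1) * q"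
      proof (rule mult_right_mono)
        have "(\<Sum>b\<in>{- int n<..int n}. of_bool (a \<le> b \<and> b \<le> u) :: real)
            = card ({- int n<..int n} \<inter> {b. a \<le> b \<and> b \<le> u})"
          by (simp add: sum_of_bool_eq)
        also have "\<dots> \<le> real (card {a..u})"
          by (intro of_nat_mono card_mono) auto
        also have "\<dots> = real_of_int u - a + 1" using au by simp
        finally show "(\<Sum>b\<in>{- int n<..int n}. of_bool (a \<le> b \<and> b \<le> u)) \<le> real_of_int u - a + 1" .
      qed (simp add: q_def)
      \<comment> \<open>The definition of \<open>speed\<close> is applied with truncation
        \<open>M = n\<close>; the term \<open>- n\<close> of the mean cancels against the count of
        levels below \<open>a\<close>.\<close>
      finally have "speed * n \<le> a + (real_of_int u - a + 1) * q + n * \<delta>"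
        using speed_le[OF n0, of n] unfolding right_edge_mean_def by simp
      show "cprob p (right_edge_ge n a) > 1 - \<eta>"
      proof (rule ccontr)
        assume "\<not> cprob p (right_edge_ge n a) > 1 - \<eta>"
        then have "(real_of_int u - a + 1) * q \<le> (real_of_int u - a + 1) * (1 - \<eta>)"
          using au unfolding q_def by (intro mult_left_mono) auto
        then have "\<eta> * (real_of_int u - a + 1) \<le> 2 * \<delta> * n + 1"
          using \<open>speed * n \<le> _\<close> u(1) by (simp add: algebra_simps)
        also have "\<dots> < \<eta> * (s * n)"
          using n1 n0 \<delta> unfolding \<delta>_def by (simp add: algebra_simps)
        also have "\<dots> \<le> \<eta> * (real_of_int u - a + 1)"
          using a u(2) n1 \<eta> by (intro mult_left_mono) (simp_all add: algebra_simps)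
        finally show False by simp
      qed
    qed
  qed
qed

text \<open>By \<open>tube_crossedI\<close> three events suffice, each failing with probability
  below \<open>\<eta> / 3\<close>: the right edge reaches \<open>X\<close>, and no path overtakes
  the line, both in the original and in the rotated picture.\<close>

lemma tube_crossed_eventually:
  assumes s: "0 < s" and \<eta>: "\<eta> > 0"
  shows "\<forall>\<^sub>F n in sequentially. cprob p (tube_crossed speed (s * real n) n) > 1 - \<eta>"
proof -
  define t where "t = min (s / 4) 1"
  have t: "0 < t" "t \<le> 1" "4 * t \<le> s" unfolding t_def using s by auto
  have "\<forall>\<^sub>F n in sequentially. cprob p (\<lambda>c. \<not> stays_below speed (t * real n) n c) < \<eta> / 3"
    using t \<eta> by (intro stays_below_eventually) auto
  moreover have "\<forall>\<^sub>F n in sequentially. \<forall>a. real_of_int a \<le> (speed - t) * real n \<and> a \<ge> - int n \<longrightarrow>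
      cprob p (right_edge_ge n a) > 1 - \<eta> / 3"
    using t \<eta> by (intro right_edge_ge_eventually) auto
  moreover have "\<forall>\<^sub>F n in sequentially. real n > 2 / t"
    using filterlim_real_sequentially unfolding filterlim_at_top_dense by blast
  ultimately show ?thesis
  proof eventually_elim
    fix n assume below: "cprob p (\<lambda>c. \<not> stays_below speed (t * real n) n c) < \<eta> / 3"
      and ge: "\<forall>a. real_of_int a \<le> (speed - t) * real n \<and> a \<ge> - int n \<longrightarrow>
        cprob p (right_edge_ge n a) > 1 - \<eta> / 3"
      and n: "real n > 2 / t"
    have n2: "2 < t * n" using n t by (simp add: field_simps)
    \<comment> \<open>\<open>X\<close> is the largest integer up to \<open>(speed - t) * n\<close>
      with the parity of \<open>n\<close>, so that \<open>(X, n)\<close> lies in \<open>LL\<close>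
      and the half turn is a symmetry.\<close>
    define X0 where "X0 = \<lfloor>(speed - t) * n\<rfloor>"
    define X where "X = (if even (X0 + int n) then X0 else X0 - 1)"
    have X_even: "even (X + int n)" unfolding X_def by auto
    have X0: "real_of_int X0 \<le> (speed - t) * n" "(speed - t) * n < real_of_int X0 + 1"
      unfolding X0_def by linarith+
    have X: "real_of_int X \<le> (speed - t) * n" "X \<ge> (speed - t) * n - 2"
      using X0 unfolding X_def by auto
    have "real_of_int (- int n) \<le> (speed - t) * n"
      using mult_right_mono[of "- 1" "speed - t" "real n"] t speed_nonneg by simp
    then have "- int n \<le> X0" unfolding X0_def by (simp add: le_floor_iff)
    then have Xn: "X \<ge> - int n" unfolding X_def by (cases "X0 = - int n") auto
    have sym: "symmetry (rotate_about (X, int n))"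
      using X_even by (intro symmetry_rotate_about) (simp add: LL_def)
    have "t * n \<ge> 0" using t by simp
    \<comment> \<open>The half-width is split into \<open>t * n\<close> for upward deviations and a
      remainder that covers the distance, at most \<open>t * n + 2\<close>, by which
      \<open>X\<close> lags behind the line.\<close>
    have sn: "s * n - t * n \<ge> t * n + 2"
      using mult_right_mono[OF t(3), of n] n2 by (simp add: algebra_simps)
    define B where "B c \<longleftrightarrow> \<not> stays_below speed (t * real n) n c" for c
    have loc: "local_on EE B" "local_on EE (\<lambda>c. B (pull (rotate_about (X, int n)) c))"
    proof -
      show *: "local_on EE B"
        unfolding B_def by (intro local_on_not local_on_stays_below)
      show "local_on EE (\<lambda>c. B (pull (rotate_about (X, int n)) c))"
        by (rule local_on_pull[OF sym * symmetry_image_EE[OF sym]])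
    qed
    have tube_loc: "local_on EE (tube_crossed speed (s * real n) n)"
      by (rule local_on_mono[OF local_on_tube_crossed tube_edges_subset_EE])
    have "1 - cprob p (tube_crossed speed (s * real n) n)
        = cprob p (\<lambda>c. \<not> tube_crossed speed (s * real n) n c)"
      by (rule cprob_not[OF p01 tube_loc, symmetric])
    also have "\<dots> \<le> cprob p (\<lambda>c. \<not> right_edge_ge n X c \<or> (B c \<or> B (pull (rotate_about (X, int n)) c)))"
    proof (rule cprob_mono[OF p01])
      fix c assume no: "\<not> tube_crossed speed (s * real n) n c"
      show "\<not> right_edge_ge n X c \<or> (B c \<or> B (pull (rotate_about (X, int n)) c))"
      proof (rule ccontr)
        assume "\<not> ?thesis"
        then have "tube_crossed speed (t * n + (s * n - t * n)) n c"
          unfolding B_def using X_even X(2) sn \<open>t * n \<ge> 0\<close>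
          by (intro tube_crossedI[of n X]) (simp_all add: algebra_simps)
        then show False using no by simp
      qed
    qed (intro local_on_disj local_on_not local_on_EE_right_edge_ge loc)
    also have "\<dots> \<le> cprob p (\<lambda>c. \<not> right_edge_ge n X c) + (cprob p B + cprob p (\<lambda>c. B (pull (rotate_about (X, int n)) c)))"
      by (intro order_trans[OF cprob_disj_le[OF p01]] add_left_mono cprob_disj_le[OF p01]
          local_on_disj local_on_not local_on_EE_right_edge_ge loc)
    also have "cprob p (\<lambda>c. B (pull (rotate_about (X, int n)) c)) = cprob p B"
      by (rule cprob_pull[OF sym loc(1) p01 order_refl])
    also have "cprob p (\<lambda>c. \<not> right_edge_ge n X c) = 1 - cprob p (right_edge_ge n X)"
      by (rule cprob_not[OF p01 local_on_EE_right_edge_ge])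
    finally show "cprob p (tube_crossed speed (s * real n) n) > 1 - \<eta>"
      using below ge X(1) Xn unfolding B_def by fastforce
  qed
qed

end

section \<open>Strips of blocks\<close>

text \<open>The plane is cut into strips parallel to the line \<open>x = \<alpha> y\<close>, so that no shear or zigzag is needed
  to follow the open paths of slope \<open>1 / \<alpha>\<close>; each strip is covered by overlapping blocks of height \<open>5 n\<close>.\<close>

locale block_lattice =
  fixes \<alpha> \<kappa> :: real and n :: nat
  assumes \<alpha>: "0 \<le> \<alpha>" "\<alpha> < 1" and \<kappa>: "0 \<le> \<kappa>" and n: "n > 0"
begin

text \<open>A tube of width \<open>2 * \<kappa>\<close> with margins of 4. They absorb the rounding
  of \<open>block_base\<close> and keep paths at \<open>skew\<close> distance at least 2 from the
  left border, the region where a token enters.\<close>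

definition width :: real where
  "width = 2 * \<kappa> + 8"

definition skew :: "vertex \<Rightarrow> real" where
  "skew u = real_of_int (fst u) - \<alpha> * real_of_int (snd u)"

definition strip :: "nat \<Rightarrow> edge set" where
  "strip i = {e \<in> EE. \<forall>u\<in>e. skew u \<in> {real i * width..<(real i + 1) * width}}"

text \<open>A point of \<open>LL\<close> next to the centre line of strip \<open>i\<close> at height
  \<open>b * n\<close>. Blocks have height \<open>5 * n\<close> and bases spaced by
  \<open>n\<close>, so every height lies in the middle fifth of some block.\<close>

definition block_base :: "nat \<Rightarrow> int \<Rightarrow> vertex" where
  "block_base i b = (let k = \<lfloor>\<alpha> * (b * int n) + (i + 1 / 2) * width\<rfloor>
     in (if even (k + b * int n) then k else k + 1, b * int n))"

definition good :: "nat \<Rightarrow> int \<Rightarrow> config \<Rightarrow> bool" where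
  "good i b c \<longleftrightarrow> tube_crossed \<alpha> \<kappa> (5 * n) (pull ((+) (block_base i b)) c)"

lemma width: "width \<ge> 8"
  unfolding width_def using \<kappa> by simp

lemma strip_subset_EE: "strip i \<subseteq> EE"
  unfolding strip_def by auto

lemma strip_disjoint:
  assumes "i \<noteq> j"
  shows "strip i \<inter> strip j = {}"
proof (rule ccontr)
  assume "strip i \<inter> strip j \<noteq> {}"
  then obtain e where e: "e \<in> strip i" "e \<in> strip j" by blast
  then obtain u where u: "u \<in> e" unfolding strip_def EE_def by blast
  have "real i * width < (real j + 1) * width" "real j * width < (real i + 1) * width"
    using e u unfolding strip_def by fastforce+
  then have "real i < real j + 1" "real j < real i + 1"
    using width by (auto simp: mult_less_cancel_right)
  then show False using assms by linarith
qed

lemma block_base: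
  shows snd_block_base: "snd (block_base i b) = b * int n"
    and block_base_LL: "block_base i b \<in> LL"
    and skew_block_base: "\<bar>skew (block_base i b) - (i + 1 / 2) * width\<bar> \<le> 1"
proof -
  show "snd (block_base i b) = b * int n" "block_base i b \<in> LL"
    unfolding block_base_def LL_def by (auto simp: Let_def)
  define t where "t = \<alpha> * (b * int n) + (i + 1 / 2) * width"
  have "\<bar>real_of_int (if even (\<lfloor>t\<rfloor> + b * int n) then \<lfloor>t\<rfloor> else \<lfloor>t\<rfloor> + 1) - t\<bar> \<le> 1"
    by (auto simp: abs_le_iff) linarith+
  then show "\<bar>skew (block_base i b) - (i + 1 / 2) * width\<bar> \<le> 1"
    unfolding block_base_def skew_def Let_def t_def by simp
qed

lemma skew_tube:
  assumes "tube \<alpha> \<kappa> x m"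
  shows "skew (block_base i b + (x, int m)) \<in> {real i * width + 2..<(real i + 1) * width}"
proof -
  have "skew (block_base i b + (x, int m)) = skew (block_base i b) + (x - \<alpha> * m)"
    unfolding skew_def by (simp add: algebra_simps)
  moreover have "\<bar>x - \<alpha> * m\<bar> \<le> \<kappa>" using assms unfolding tube_def by blast
  moreover have "(real i + 1 / 2) * width = i * width + \<kappa> + 4" "(real i + 1) * width = i * width + 2 * \<kappa> + 8"
    unfolding width_def by (simp_all add: algebra_simps)
  ultimately show ?thesis
    using skew_block_base[of i b] unfolding abs_le_iff atLeastLessThan_iff by linarith
qed

lemma local_on_good: "local_on (strip i) (good i b)"
  unfolding good_def
proof (rule local_on_pull[OF symmetry_translate[OF block_base_LL] local_on_tube_crossed], rule subsetI)
  fix e assume "e \<in> image ((+) (block_base i b)) ` region_edges (tube \<alpha> \<kappa>) (5 * n)"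
  then obtain e' where e': "e' \<in> region_edges (tube \<alpha> \<kappa>) (5 * n)" "e = (+) (block_base i b) ` e'"
    by blast
  have "e \<in> EE"
    using e' tube_edges_subset_EE symmetry_image_EE[OF symmetry_translate[OF block_base_LL]] by blast
  moreover obtain x x' m where "e' = {(x, int m), (x', int m + 1)}" "tube \<alpha> \<kappa> x m" "tube \<alpha> \<kappa> x' (Suc m)"
    using e'(1) unfolding region_edges_def by blast
  then have "\<forall>u\<in>e. skew u \<in> {real i * width..<(real i + 1) * width}"
    using skew_tube[of x m i b] skew_tube[of x' "Suc m" i b] e'(2) by (auto simp: add.commute)
  ultimately show "e \<in> strip i" unfolding strip_def by blast
qed

lemma cprob_good:
  "p \<in> {0..1} \<Longrightarrow> cprob p (good i b) = cprob p (tube_crossed \<alpha> \<kappa> (5 * n))"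
  unfolding good_def
  by (rule cprob_pull[OF symmetry_translate[OF block_base_LL] local_on_tube_crossed _ tube_edges_subset_EE])

definition block_path :: "config \<Rightarrow> nat \<Rightarrow> int \<Rightarrow> (int \<Rightarrow> int) \<Rightarrow> bool" where
  "block_path c i b f \<longleftrightarrow>
     (\<forall>y\<in>{b * int n..b * int n + 5 * int n}. (f y, y) \<in> LL \<and> skew (f y, y) \<in> {real i * width + 2..<(real i + 1) * width}) \<and>
     (\<forall>y\<in>{b * int n..<b * int n + 5 * int n}. \<bar>f (y + 1) - f y\<bar> = 1 \<and> c {(f y, y), (f (y + 1), y + 1)})"

lemma good_block_path:
  assumes "good i b c"
  shows "\<exists>f. block_path c i b f"
proof -
  obtain a where a: "block_base i b = (a, b * int n)"
    using snd_block_base[of i b] by (cases "block_base i b") auto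
  obtain x where "reach (tube \<alpha> \<kappa>) (pull ((+) (a, b * int n)) c) (5 * n) x"
    using assms unfolding good_def tube_crossed_iff a by blast
  then obtain g where g: "\<And>m. m \<le> 5 * n \<Longrightarrow> tube \<alpha> \<kappa> (g m) m"
    "\<And>m. m < 5 * n \<Longrightarrow> \<bar>g (Suc m) - g m\<bar> = 1"
    "\<And>m. m < 5 * n \<Longrightarrow> pull ((+) (a, b * int n)) c {(g m, int m), (g (Suc m), int m + 1)}"
    using reach_path[of "tube \<alpha> \<kappa>" _ "5 * n" x] by blast
  define f where "f y = a + g (nat (y - b * int n))" for y
  have "(f y, y) \<in> LL \<and> skew (f y, y) \<in> {real i * width + 2..<(real i + 1) * width}"
    if "y \<in> {b * int n..b * int n + 5 * int n}" for y
  proof -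
    define m where "m = nat (y - b * int n)"
    have m: "m \<le> 5 * n" "y = b * int n + int m" unfolding m_def using that by auto
    have "(f y, y) = block_base i b + (g m, int m)"
      unfolding f_def m_def[symmetric] a using m(2) by simp
    moreover have "even (a + b * int n)" using block_base_LL[of i b] unfolding a LL_def by simp
    then have "(f y, y) \<in> LL"
      using g(1)[OF m(1)] unfolding f_def m_def[symmetric] LL_def tube_def m(2) by auto
    ultimately show ?thesis using skew_tube[OF g(1)[OF m(1)], of i b] by metis
  qed
  moreover have "\<bar>f (y + 1) - f y\<bar> = 1 \<and> c {(f y, y), (f (y + 1), y + 1)}"
    if "y \<in> {b * int n..<b * int n + 5 * int n}" for y
  proof -
    define m where "m = nat (y - b * int n)"
    have m: "m < 5 * n" "y = b * int n + int m" "nat (y + 1 - b * int n) = Suc m"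
      unfolding m_def using that by auto
    show ?thesis
      using g(2,3)[OF m(1)] unfolding f_def m(3) m_def[symmetric]
      by (simp add: pull_translate_edge m(2) add.assoc)
  qed
  ultimately show ?thesis unfolding block_path_def by blast
qed

text \<open>The blocks met by a token starting at the origin: height 0 lies in the middle fifth of
  block \<open>-2\<close>, and \<open>enter_strip\<close> shows that the index changes by at most 4
  per strip.\<close>

definition block_sequence :: "nat \<Rightarrow> (nat \<Rightarrow> int) \<Rightarrow> bool" where
  "block_sequence m B \<longleftrightarrow> B 0 = - 2 \<and> (\<forall>j. Suc j < m \<longrightarrow> \<bar>B (Suc j) - B j\<bar> \<le> 4)"

definition mostly_good :: "config \<Rightarrow> bool" where
  "mostly_good c \<longleftrightarrow> (\<forall>m B. block_sequence m B \<longrightarrow> m \<le> 2 * card {j\<in>{..<m}. good j (B j) c})"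

text \<open>A block sequence is coded by its increments, so that finitely many lists remain and the
  event is local; \<open>S\<close> is a set of at least half of the strips, all with a bad
  block.\<close>

definition many_bad :: "nat \<Rightarrow> config \<Rightarrow> bool" where
  "many_bad m c \<longleftrightarrow> (\<exists>ds\<in>{ds. set ds \<subseteq> {-4..4} \<and> length ds = m}. \<exists>S\<in>{S. S \<subseteq> {..<m} \<and> m \<le> 2 * card S}.
     \<forall>j\<in>S. \<not> good j (- 2 + sum_list (take j ds)) c)"

lemma finite_increments: "finite {ds :: int list. set ds \<subseteq> {-4..4} \<and> length ds = m}"
  by (rule finite_lists_length_eq) simp

lemma finite_bad_sets: "finite {S :: nat set. S \<subseteq> {..<m} \<and> m \<le> 2 * card S}"
  by (rule finite_subset[of _ "Pow {..<m}"]) auto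

lemma local_on_many_bad: "local_on EE (many_bad m)"
  unfolding many_bad_def[abs_def]
proof (intro local_on_Bex finite_increments finite_bad_sets)
  fix ds :: "int list" and S :: "nat set"
  assume "S \<in> {S. S \<subseteq> {..<m} \<and> m \<le> 2 * card S}"
  then have "finite S" using finite_subset[of S "{..<m}"] by simp
  then show "local_on EE (\<lambda>c. \<forall>j\<in>S. \<not> good j (- 2 + sum_list (take j ds)) c)"
    by (intro local_on_Ball local_on_not local_on_mono[OF local_on_good strip_subset_EE])
qed

lemma mostly_goodI:
  assumes "\<And>m. m > 0 \<Longrightarrow> \<not> many_bad m c"
  shows "mostly_good c"
  unfolding mostly_good_def
proof (intro allI impI, rule ccontr)
  fix m B assume B: "block_sequence m B" and less: "\<not> m \<le> 2 * card {j\<in>{..<m}. good j (B j) c}"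
  \<comment> \<open>The final 0 pads the list to length \<open>m\<close>; it does not enter
    \<open>take j ds\<close> for \<open>j < m\<close>.\<close>
  define ds where "ds = map (\<lambda>j. if Suc j < m then B (Suc j) - B j else 0) [0..<m]"
  have ds_mem: "set ds \<subseteq> {-4..4}" "length ds = m"
    using B unfolding ds_def block_sequence_def by (auto simp: abs_le_iff)
  have ds: "- 2 + sum_list (take j ds) = B j" if "j < m" for j
    using that
  proof (induction j)
    case (Suc j)
    then show ?case by (simp add: take_Suc_conv_app_nth ds_mem(2)) (simp add: ds_def)
  qed (use B in \<open>simp add: block_sequence_def\<close>)
  define S where "S = {j\<in>{..<m}. \<not> good j (B j) c}"
  have "card ({j\<in>{..<m}. good j (B j) c} \<union> S) = card {j\<in>{..<m}. good j (B j) c} + card S"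
    unfolding S_def by (rule card_Un_disjoint) auto
  moreover have "{j\<in>{..<m}. good j (B j) c} \<union> S = {..<m}" unfolding S_def by auto
  ultimately have "m = card {j\<in>{..<m}. good j (B j) c} + card S" by simp
  then have "m \<le> 2 * card S" using less by linarith
  moreover have "S \<subseteq> {..<m}" "\<forall>j\<in>S. \<not> good j (- 2 + sum_list (take j ds)) c"
    unfolding S_def using ds by auto
  ultimately have "many_bad m c"
    unfolding many_bad_def using ds_mem by (intro bexI[of _ ds] bexI[of _ S]) simp_all
  moreover have "m > 0" using less by (cases m) simp_all
  ultimately show False using assms by blast
qed

text \<open>Blocks in distinct strips are independent, so \<open>m / 2\<close> bad ones have
  probability at most \<open>(1 / 72) ^ m\<close>. There are at most \<open>9 ^ m\<close> increment
  lists and \<open>2 ^ m\<close> sets \<open>S\<close>, and \<open>18 / 72 = 1 / 4\<close>.\<close>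

lemma cprob_many_bad:
  assumes p: "p \<in> {0..1}" and likely: "cprob p (tube_crossed \<alpha> \<kappa> (5 * n)) \<ge> 1 - (1 / 72)\<^sup>2"
  shows "cprob p (many_bad m) \<le> (1 / 4) ^ m"
proof -
  define DS where "DS = {ds :: int list. set ds \<subseteq> {-4..4} \<and> length ds = m}"
  define SS where "SS = {S. S \<subseteq> {..<m} \<and> m \<le> 2 * card S}"
  have fin: "finite DS" "finite SS"
    unfolding DS_def SS_def by (rule finite_increments finite_bad_sets)+
  define Q where "Q ds S c \<longleftrightarrow> (\<forall>j\<in>S. \<not> good j (- 2 + sum_list (take j ds)) c)" for ds S c
  have fin_S: "finite S" if "S \<in> SS" for S
    using that finite_subset[of S "{..<m}"] unfolding SS_def by simp
  have loc: "local_on EE (Q ds S)" if "S \<in> SS" for ds S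
    unfolding Q_def[abs_def] using fin_S[OF that]
    by (intro local_on_Ball local_on_not local_on_mono[OF local_on_good strip_subset_EE])
  have bound: "cprob p (Q ds S) \<le> (1 / 72) ^ m" if S: "S \<in> SS" for ds S
  proof -
    have bad: "cprob p (\<lambda>c. \<not> good j b c) \<le> (1 / 72)\<^sup>2" for j b
      using cprob_not[OF p local_on_mono[OF local_on_good strip_subset_EE]] likely cprob_good[OF p]
      by simp
    have "cprob p (Q ds S) = (\<Prod>j\<in>S. cprob p (\<lambda>c. \<not> good j (- 2 + sum_list (take j ds)) c))"
      unfolding Q_def[abs_def] using fin_S[OF S] strip_subset_EE strip_disjoint
      by (intro cprob_indep_Ball[OF p, of _ strip] local_on_not local_on_good) auto
    also have "\<dots> \<le> (\<Prod>j\<in>S. (1 / 72)\<^sup>2)"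
      by (intro prod_mono conjI cprob_nonneg bad)
    also have "\<dots> = (1 / 72) ^ (2 * card S)"
      by (simp add: power_mult)
    also have "\<dots> \<le> (1 / 72) ^ m"
      using S unfolding SS_def by (intro power_decreasing) auto
    finally show ?thesis .
  qed
  have "cprob p (many_bad m) = cprob p (\<lambda>c. \<exists>ds\<in>DS. \<exists>S\<in>SS. Q ds S c)"
    unfolding many_bad_def[abs_def] DS_def SS_def Q_def ..
  also have "\<dots> \<le> (\<Sum>ds\<in>DS. cprob p (\<lambda>c. \<exists>S\<in>SS. Q ds S c))"
    using fin loc by (intro cprob_Bex_le[OF p] local_on_Bex) auto
  also have "\<dots> \<le> (\<Sum>ds\<in>DS. \<Sum>S\<in>SS. cprob p (Q ds S))"
    using fin loc by (intro sum_mono cprob_Bex_le[OF p]) auto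
  also have "\<dots> \<le> (\<Sum>ds\<in>DS. \<Sum>S\<in>SS. (1 / 72) ^ m)"
    using bound by (intro sum_mono) auto
  also have "\<dots> = real (card DS) * real (card SS) * (1 / 72) ^ m"
    by simp
  also have "\<dots> \<le> 9 ^ m * 2 ^ m * (1 / 72) ^ m"
  proof (intro mult_right_mono mult_mono)
    show "real (card DS) \<le> 9 ^ m"
      unfolding DS_def by (subst card_lists_length_eq) auto
    have "card SS \<le> card (Pow {..<m})"
      unfolding SS_def by (intro card_mono) auto
    then show "real (card SS) \<le> 2 ^ m"
      by (simp add: card_Pow)
  qed auto
  also have "\<dots> = (1 / 4) ^ m"
    by (simp flip: power_mult_distrib)
  finally show ?thesis .
qed

text \<open>The failure probabilities sum to at most \<open>1 / 3\<close>, so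
  \<open>mostly_good\<close> cannot fail almost surely, and some configuration has it together with
  the almost sure property \<open>P\<close>.\<close>

lemma mostly_good_exists:
  assumes p: "p \<in> {0..1}" and likely: "cprob p (tube_crossed \<alpha> \<kappa> (5 * n)) \<ge> 1 - (1 / 72)\<^sup>2"
    and ae: "AE c in config_measure p. P c"
  shows "\<exists>c. P c \<and> mostly_good c"
proof (rule ccontr)
  assume none: "\<not> ?thesis"
  interpret prob_space "config_measure p" by (rule prob_space_config_measure)
  define N where "N m = {c \<in> space (config_measure p). many_bad (Suc m) c}" for m
  have N: "range N \<subseteq> events"
    unfolding N_def using sets_local_on[OF p local_on_many_bad] by blast
  have N_le: "prob (N m) \<le> (1 / 4) ^ Suc m" for m
    using cprob_many_bad[OF p likely, of "Suc m"] unfolding N_def cprob_def .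
  have "AE c in config_measure p. c \<in> (\<Union>m. N m)"
    using ae AE_space
  proof eventually_elim
    case (elim c)
    then have "\<not> mostly_good c" using none by blast
    then obtain m where "m > 0" "many_bad m c" using mostly_goodI by blast
    then show ?case using elim unfolding N_def by (auto intro!: exI[of _ "m - 1"])
  qed
  then have one: "prob (\<Union>m. N m) = 1"
    using N by (subst prob_eq_1) auto
  have sums: "(\<lambda>m. (1 / 4) ^ Suc m :: real) sums (1 / 3)"
    using sums_mult[OF geometric_sums[of "1 / 4 :: real"], of "1 / 4"] by simp
  have "summable (\<lambda>m. prob (N m))"
    by (rule summable_comparison_test'[OF sums_summable[OF sums], of 0]) (use N_le in auto)
  then have "prob (\<Union>m. N m) \<le> (\<Sum>m. prob (N m))"
    using finite_measure_subadditive_countably[OF N] by blast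
  also have "\<dots> \<le> (\<Sum>m. (1 / 4) ^ Suc m)"
    using N_le sums \<open>summable (\<lambda>m. prob (N m))\<close> by (intro suminf_le) (auto dest: sums_summable)
  finally show False
    using sums_unique[OF sums] one by simp
qed

end

section \<open>A strategy for the second player\<close>

text \<open>In each strip the second player moves right until the token meets the open path of the current
  block (\<open>Seek\<close>), stays on that path until the first player pushes the token over one of its ends
  (\<open>Follow\<close>), and then moves right until the next strip (\<open>Pass\<close>).  If the block has no open path,
  the token crosses the whole strip in phase \<open>Seek\<close>.  The argument of a phase counts its stages.\<close>

datatype phase = Seek nat | Follow nat | Pass nat

locale good_blocks = block_lattice +
  fixes c :: config and path :: "nat \<Rightarrow> int \<Rightarrow> int \<Rightarrow> int"
  assumes path: "\<And>i b. good i b c \<Longrightarrow> block_path c i b (path i b)"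
    and sweep_le: "width / (1 - \<alpha>) + 1 \<le> n"
begin

text \<open>Each move to the right gains at least \<open>1 - \<alpha>\<close> in
  \<open>skew\<close>, so this bounds the number of such moves within one strip. By
  \<open>sweep_le\<close> the height changes by at most \<open>n\<close> meanwhile.\<close>

definition sweep :: real where
  "sweep = width / (1 - \<alpha>) + 1"

definition num_good :: "nat \<Rightarrow> (nat \<Rightarrow> int) \<Rightarrow> nat" where
  "num_good i B = card {j\<in>{..<i}. good j (B j) c}"

lemma num_good_Suc: "num_good (Suc i) B = num_good i B + of_bool (good i (B i) c)"
proof -
  have "{j\<in>{..<Suc i}. good j (B j) c}
      = (if good i (B i) c then insert i {j\<in>{..<i}. good j (B j) c} else {j\<in>{..<i}. good j (B j) c})"
    by (auto simp: less_Suc_eq)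
  then show ?thesis unfolding num_good_def by simp
qed

text \<open>\<open>L\<close> and \<open>G\<close> count the moves to the right and the moves along open paths;
  strip \<open>j\<close> was entered at block \<open>B j\<close>.\<close>

definition phase_inv :: "vertex \<Rightarrow> nat \<Rightarrow> (nat \<Rightarrow> int) \<Rightarrow> nat \<Rightarrow> nat \<Rightarrow> phase \<Rightarrow> bool" where
  "phase_inv u i B L G ph = (case ph of
     Seek k \<Rightarrow> L \<le> 2 * sweep * i + k \<and> G \<ge> n * num_good i B \<and>
       (1 - \<alpha>) * k \<le> skew u - i * width \<and>
       (B i + 2) * int n - int k \<le> snd u \<and> snd u \<le> (B i + 3) * int n + int k \<and>
       (good i (B i) c \<longrightarrow> fst u < path i (B i) (snd u))
   | Follow g \<Rightarrow> L \<le> 2 * sweep * i + sweep \<and> G \<ge> n * num_good i B + g \<and>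
       good i (B i) c \<and> fst u = path i (B i) (snd u) \<and>
       B i * int n \<le> snd u \<and> snd u \<le> (B i + 5) * int n \<and>
       int n - int g \<le> snd u - B i * int n \<and> int n - int g \<le> (B i + 5) * int n - snd u
   | Pass k \<Rightarrow> L \<le> 2 * sweep * i + sweep + k \<and> G \<ge> n * num_good (Suc i) B \<and>
       (1 - \<alpha>) * k \<le> skew u - i * width \<and>
       B i * int n - int k \<le> snd u \<and> snd u \<le> (B i + 5) * int n + int k)"

text \<open>Strip, block sequence and phase are hidden by quantifiers, so a step only has to track
  the position and two counters. Each strip costs at most \<open>2 * sweep\<close> moves to the
  right, one sweep before and one after the path, and each good block left behind has paid at least
  \<open>n\<close> moves along its path.\<close>

definition state_inv :: "vertex \<Rightarrow> nat \<Rightarrow> nat \<Rightarrow> bool" where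
  "state_inv u L G \<longleftrightarrow> (\<exists>i B ph. u \<in> LL \<and> skew u \<in> {i * width..<(real i + 1) * width} \<and>
     block_sequence (Suc i) B \<and> phase_inv u i B L G ph)"

lemma state_invI:
  "u \<in> LL \<Longrightarrow> i * width \<le> skew u \<Longrightarrow> skew u < (real i + 1) * width \<Longrightarrow>
    block_sequence (Suc i) B \<Longrightarrow> phase_inv u i B L G ph \<Longrightarrow> state_inv u L G"
  unfolding state_inv_def by auto

lemma path_in_strip:
  assumes "good i b c" "b * int n \<le> y" "y \<le> (b + 5) * int n"
  shows "(path i b y, y) \<in> LL" "real i * width + 2 \<le> skew (path i b y, y)"
    "skew (path i b y, y) < (real i + 1) * width"
  using path[OF assms(1)] assms(2,3) unfolding block_path_def by (auto simp: algebra_simps)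

lemma path_step:
  assumes "good i b c" "b * int n \<le> y" "y < (b + 5) * int n"
  shows "\<bar>path i b (y + 1) - path i b y\<bar> = 1" "c {(path i b y, y), (path i b (y + 1), y + 1)}"
  using path[OF assms(1)] assms(2,3) unfolding block_path_def by (auto simp: algebra_simps)

lemma path_step_either:
  assumes "good i b c" "b * int n \<le> y" "y \<le> (b + 5) * int n"
    "b * int n \<le> y'" "y' \<le> (b + 5) * int n" "\<bar>y' - y\<bar> = 1"
  shows "\<bar>path i b y' - path i b y\<bar> = 1" "c {(path i b y, y), (path i b y', y')}"
proof -
  have "y' = y + 1 \<or> y = y' + 1" using assms(6) by linarith
  then show "\<bar>path i b y' - path i b y\<bar> = 1" "c {(path i b y, y), (path i b y', y')}"
    using path_step[OF assms(1), of y] path_step[OF assms(1), of y'] assms(2-5)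
    by (auto simp: insert_commute abs_minus_commute)
qed

section \<open>Maintaining the invariant along a play\<close>

lemma sweep_step:
  assumes "(1 - \<alpha>) * real k \<le> s - real i * width" "s < (real i + 1) * width"
  shows "real k + 1 \<le> sweep" "int k + 1 \<le> int n"
proof -
  have "(1 - \<alpha>) * real k < width" using assms by (simp add: algebra_simps)
  then have "real k < width / (1 - \<alpha>)" using \<alpha> by (simp add: field_simps)
  then show 1: "real k + 1 \<le> sweep" unfolding sweep_def by simp
  then show "int k + 1 \<le> int n" using sweep_le unfolding sweep_def by linarith
qed

lemma sweep_pos: "sweep > 0"
  unfolding sweep_def using width \<alpha> by (simp add: add_pos_pos)

lemma move_LL: "u \<in> LL \<Longrightarrow> move u a r \<in> LL"
  using adjacent_move[of u a r] unfolding adjacent_def by blast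

lemma move_Right:
  "fst (move u a Right) = fst u + 1" "\<bar>snd (move u a Right) - snd u\<bar> = 1"
  "skew u + (1 - \<alpha>) \<le> skew (move u a Right)" "skew (move u a Right) \<le> skew u + (1 + \<alpha>)"
  using \<alpha> by (cases u; cases a; simp add: skew_def algebra_simps)+

text \<open>A new block is chosen with the token in its middle fifth. A token that has just entered
  is less than 2 from the left border in \<open>skew\<close>, hence strictly to the left of the
  path.\<close>

lemma enter_strip:
  assumes u: "u \<in> LL" "(real i + 1) * width \<le> skew u" "skew u < (real i + 1) * width + 2"
    and B: "block_sequence (Suc i) B"
    and y: "B i * int n - int n \<le> snd u" "snd u \<le> (B i + 5) * int n + int n"
    and L: "real L \<le> 2 * sweep * i + 2 * sweep" and G: "G \<ge> n * num_good (Suc i) B"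
  shows "state_inv u L G"
proof (rule state_invI)
  \<comment> \<open>The token is at a height between \<open>(b + 2) * n\<close> and
    \<open>(b + 3) * n\<close>; \<open>div\<close> rounds down for negative heights as well.\<close>
  define b where "b = snd u div int n - 2"
  have b: "(b + 2) * int n \<le> snd u" "snd u < (b + 3) * int n"
  proof -
    define d m where "d = snd u div int n" and "m = snd u mod int n"
    have "snd u = d * int n + m" unfolding d_def m_def by simp
    moreover have "0 \<le> m" "m < int n" unfolding m_def using n by simp_all
    ultimately show "(b + 2) * int n \<le> snd u" "snd u < (b + 3) * int n"
      unfolding b_def d_def[symmetric] by (simp_all add: algebra_simps)
  qed
  have "(B i - 1) * int n < (b + 3) * int n" "(b + 2) * int n < (B i + 7) * int n"
    using b y n by (auto simp: algebra_simps)
  then have "B i - 1 < b + 3" "b + 2 < B i + 7"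
    using n by (auto simp: mult_less_cancel_right)
  then have near: "\<bar>b - B i\<bar> \<le> 4" by linarith
  show "block_sequence (Suc (Suc i)) (B(Suc i := b))"
    using B near unfolding block_sequence_def by (auto simp: less_Suc_eq)
  have "num_good (Suc i) (B(Suc i := b)) = num_good (Suc i) B"
    unfolding num_good_def by (rule arg_cong[of _ _ card]) auto
  moreover have "fst u < path (Suc i) b (snd u)" if "good (Suc i) b c"
  proof -
    have "real (Suc i) * width + 2 \<le> skew (path (Suc i) b (snd u), snd u)"
      using that b n by (intro path_in_strip) (auto simp: algebra_simps)
    then show ?thesis using u(3) unfolding skew_def by (simp add: algebra_simps)
  qed
  ultimately show "phase_inv u (Suc i) (B(Suc i := b)) L G (Seek 0)"
    using u b L G unfolding phase_inv_def by (auto simp: algebra_simps)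
  show "real (Suc i) * width \<le> skew u" "skew u < (real (Suc i) + 1) * width"
    using u width by (auto simp: algebra_simps)
qed (rule u)

text \<open>A move to the right never leaves the strip on its left side and overshoots the right
  border by less than 2, which is what \<open>enter_strip\<close> accepts.\<close>

lemma state_inv_step:
  assumes "state_inv u L G"
  shows "\<exists>r. state_inv (move u a r) (Suc L) G \<or>
    state_inv (move u a r) L (Suc G) \<and> c {u, move u a r}"
proof -
  obtain i B ph where inv: "u \<in> LL" "real i * width \<le> skew u" "skew u < (real i + 1) * width"
    "block_sequence (Suc i) B" "phase_inv u i B L G ph"
    using assms unfolding state_inv_def by auto
  define w where "w = move u a Right"
  have w: "w \<in> LL" "fst w = fst u + 1" "\<bar>snd w - snd u\<bar> = 1"
    "skew u + (1 - \<alpha>) \<le> skew w" "skew w < skew u + 2"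
    unfolding w_def using move_LL[OF inv(1)] move_Right[of u a] \<alpha> by auto
  have ge: "real i * width \<le> skew w" using w(4) inv(2) \<alpha> by simp
  have lt: "skew w < (real i + 1) * width + 2" using w(5) inv(3) by simp
  show ?thesis
  proof (cases ph)
    case (Seek k)
    have I: "real L \<le> 2 * sweep * i + k" "G \<ge> n * num_good i B"
      "(1 - \<alpha>) * k \<le> skew u - i * width"
      "(B i + 2) * int n - int k \<le> snd u" "snd u \<le> (B i + 3) * int n + int k"
      "good i (B i) c \<Longrightarrow> fst u < path i (B i) (snd u)"
      using inv(5) unfolding phase_inv_def Seek by auto
    have k: "real k + 1 \<le> sweep" "int k + 1 \<le> int n"
      using sweep_step[OF I(3) inv(3)] by auto
    have y: "(B i + 2) * int n - int (Suc k) \<le> snd w" "snd w \<le> (B i + 3) * int n + int (Suc k)"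
      using I(4,5) w(3) by auto
    have y': "(B i + 1) * int n \<le> snd w" "snd w \<le> (B i + 4) * int n"
      using y k(2) by (auto simp: algebra_simps)
    have sk: "(1 - \<alpha>) * Suc k \<le> skew w - i * width"
      using I(3) w(4) by (simp add: algebra_simps)
    show ?thesis
    proof (cases "good i (B i) c")
      case True
      have range: "B i * int n \<le> snd u" "snd u \<le> (B i + 5) * int n"
        "B i * int n \<le> snd w" "snd w \<le> (B i + 5) * int n"
        using I(4,5) k(2) y' n by (auto simp: algebra_simps)
      define f where "f = path i (B i)"
      \<comment> \<open>By parity a token to the left of the path is at least 2 away from it. Token
        and path each move by 1, so the token may meet the path but cannot jump over it.\<close>
      have "even (f (snd u) + snd u)" "even (fst u + snd u)"
        using path_in_strip(1)[OF True range(1,2)] inv(1) unfolding f_def LL_def by (auto split: prod.splits)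
      then have "fst u \<le> f (snd u) - 2"
        using I(6)[OF True] unfolding f_def[symmetric] by presburger
      moreover have "\<bar>f (snd w) - f (snd u)\<bar> = 1"
        unfolding f_def by (rule path_step_either[OF True range w(3)])
      ultimately have fw: "fst w \<le> f (snd w)" using w(2) by linarith
      have "skew w \<le> skew (f (snd w), snd w)"
        using fw unfolding skew_def by simp
      then have inside: "skew w < (real i + 1) * width"
        using path_in_strip(3)[OF True range(3,4)] unfolding f_def by linarith
      \<comment> \<open>Seeking began in the middle fifth and lasted at most \<open>n\<close>
        stages, so the path is met at distance at least \<open>n\<close> from both ends, as
        \<open>Follow 0\<close> demands.\<close>
      have "phase_inv w i B (Suc L) G (if fst w = f (snd w) then Follow 0 else Seek (Suc k))"
        using I(1,2) k y y' range(3,4) sk fw True unfolding phase_inv_def f_def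
        by (auto simp: algebra_simps)
      then show ?thesis
        using state_invI[OF w(1) ge inside inv(4)] unfolding w_def by blast
    next
      case False
      show ?thesis
      proof (cases "skew w < (real i + 1) * width")
        case True
        have "phase_inv w i B (Suc L) G (Seek (Suc k))"
          using I(1,2) y sk False unfolding phase_inv_def by auto
        then show ?thesis
          using state_invI[OF w(1) ge True inv(4)] unfolding w_def by blast
      next
        case False': False
        have "state_inv w (Suc L) G"
          by (rule enter_strip[OF w(1) _ lt inv(4)])
             (use False' y' I(1,2) k(1) n False num_good_Suc[of i B] sweep_pos in \<open>auto simp: algebra_simps\<close>)
        then show ?thesis unfolding w_def by blast
      qed
    qed
  next
    case (Follow g)
    have I: "real L \<le> 2 * sweep * i + sweep" "G \<ge> n * num_good i B + g"
      "good i (B i) c" "fst u = path i (B i) (snd u)"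
      "B i * int n \<le> snd u" "snd u \<le> (B i + 5) * int n"
      "int n - int g \<le> snd u - B i * int n" "int n - int g \<le> (B i + 5) * int n - snd u"
      using inv(5) unfolding phase_inv_def Follow by auto
    define y where "y = (case a of Top \<Rightarrow> snd u + 1 | Bottom \<Rightarrow> snd u - 1)"
    have y: "\<bar>y - snd u\<bar> = 1" "snd w = y"
      unfolding y_def w_def by (cases u; cases a; simp)+
    show ?thesis
    proof (cases "B i * int n \<le> y \<and> y \<le> (B i + 5) * int n")
      case True
      \<comment> \<open>The path is a function of the height, so it can be followed upwards and
        downwards alike: the first player picks the vertical direction, and \<open>r\<close> is the
        horizontal one dictated by the path.\<close>
      note step = path_step_either[OF I(3,5,6) True[THEN conjunct1] True[THEN conjunct2] y(1)]
      define x where "x = path i (B i) y"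
      have "x = fst u + 1 \<or> x = fst u - 1"
        using step(1) unfolding x_def I(4) by linarith
      moreover have "move u a Right = (fst u + 1, y)" "move u a Left = (fst u - 1, y)"
        unfolding y_def by (cases u; cases a; simp)+
      ultimately obtain r where r: "move u a r = (x, y)" by metis
      have op: "c {u, move u a r}"
        using step(2) unfolding r x_def by (simp add: I(4)[symmetric])
      have "state_inv (x, y) L (Suc G)"
      proof (rule state_invI[OF _ _ _ inv(4)])
        show "(x, y) \<in> LL" "real i * width \<le> skew (x, y)" "skew (x, y) < (real i + 1) * width"
          using path_in_strip[OF I(3) True[THEN conjunct1] True[THEN conjunct2]] unfolding x_def by auto
        show "phase_inv (x, y) i B L (Suc G) (Follow (Suc g))"
          using I True y(1) unfolding phase_inv_def x_def by auto
      qed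
      then have "state_inv (move u a r) L (Suc G)" using r by simp
      then show ?thesis using op by blast
    next
      case False
      \<comment> \<open>The token is pushed over an end of the path. Since it joined the path at
        distance at least \<open>n\<close> from both ends, it has spent at least \<open>n\<close>
        stages there.\<close>
      then have "snd u = B i * int n \<or> snd u = (B i + 5) * int n"
        using I(5,6) y(1) by linarith
      then have "int g \<ge> int n" using I(7,8) by auto
      then have G: "G \<ge> n * num_good (Suc i) B"
        using I(2,3) num_good_Suc[of i B] by (simp add: algebra_simps)
      show ?thesis
      proof (cases "skew w < (real i + 1) * width")
        case True
        have "phase_inv w i B (Suc L) G (Pass 1)"
          using I(1,5,6) G w(3,4) inv(2) unfolding phase_inv_def by auto
        then show ?thesis
          using state_invI[OF w(1) ge True inv(4)] unfolding w_def by blast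
      next
        case False
        have "1 \<le> sweep" unfolding sweep_def using width \<alpha> by simp
        have "state_inv w (Suc L) G"
          by (rule enter_strip[OF w(1) _ lt inv(4)])
             (use False I(1,5,6) w(3) n G \<open>1 \<le> sweep\<close> in auto)
        then show ?thesis unfolding w_def by blast
      qed
    qed
  next
    case (Pass k)
    have I: "real L \<le> 2 * sweep * i + sweep + k" "G \<ge> n * num_good (Suc i) B"
      "(1 - \<alpha>) * k \<le> skew u - i * width"
      "B i * int n - int k \<le> snd u" "snd u \<le> (B i + 5) * int n + int k"
      using inv(5) unfolding phase_inv_def Pass by auto
    have k: "real k + 1 \<le> sweep" "int k + 1 \<le> int n"
      using sweep_step[OF I(3) inv(3)] by auto
    show ?thesis
    proof (cases "skew w < (real i + 1) * width")
      case True
      have "phase_inv w i B (Suc L) G (Pass (Suc k))"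
        using I w(3,4) unfolding phase_inv_def by (auto simp: algebra_simps)
      then show ?thesis
        using state_invI[OF w(1) ge True inv(4)] unfolding w_def by blast
    next
      case False
      have "state_inv w (Suc L) G"
        by (rule enter_strip[OF w(1) _ lt inv(4)])
           (use False I w(3) k in auto)
      then show ?thesis unfolding w_def by blast
    qed
  qed
qed

section \<open>From the invariant to the payoff\<close>

lemma state_inv_origin: "state_inv (0, 0) 0 0"
proof (rule state_invI[of _ 0 "\<lambda>_. - 2" _ _ "Seek 0"])
  have "0 < path 0 (- 2) 0" if "good 0 (- 2) c"
    using path_in_strip(2)[OF that, of 0] unfolding skew_def by simp
  then show "phase_inv (0, 0) 0 (\<lambda>_. - 2) 0 0 (Seek 0)"
    unfolding phase_inv_def num_good_def by (simp add: skew_def)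
qed (use width in \<open>auto simp: LL_def skew_def block_sequence_def\<close>)

text \<open>At least half of the \<open>i\<close> strips left behind were good and each paid
  \<open>n\<close>, so \<open>i \<le> 2 * G / n\<close>; the current strip accounts for the additive
  \<open>2 * sweep\<close>.\<close>

lemma state_inv_loss_le:
  assumes "state_inv u L G" "mostly_good c"
  shows "real L \<le> 4 * sweep / n * G + 2 * sweep"
proof -
  obtain i B ph where inv: "skew u < (real i + 1) * width"
    "block_sequence (Suc i) B" "phase_inv u i B L G ph"
    using assms unfolding state_inv_def by auto
  have "block_sequence i B" using inv(2) unfolding block_sequence_def by auto
  then have i: "i \<le> 2 * num_good i B"
    using assms(2) unfolding mostly_good_def num_good_def by blast
  have L: "real L \<le> 2 * sweep * i + 2 * sweep" and G: "n * num_good i B \<le> G"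
  proof (atomize (full), cases ph)
    case (Seek k)
    then show "real L \<le> 2 * sweep * i + 2 * sweep \<and> n * num_good i B \<le> G"
      using inv(3) sweep_step[OF _ inv(1), of k] sweep_pos unfolding phase_inv_def by auto
  next
    case (Follow g)
    then show "real L \<le> 2 * sweep * i + 2 * sweep \<and> n * num_good i B \<le> G"
      using inv(3) sweep_pos unfolding phase_inv_def by auto
  next
    case (Pass k)
    then show "real L \<le> 2 * sweep * i + 2 * sweep \<and> n * num_good i B \<le> G"
      using inv(3) sweep_step[OF _ inv(1), of k] num_good_Suc[of i B] unfolding phase_inv_def
      by (auto simp: algebra_simps)
  qed
  have "real i * n \<le> 2 * real (n * num_good i B)"
    using i by (metis mult.assoc mult.commute mult_le_mono1 of_nat_le_iff of_nat_mult of_nat_numeral)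
  also have "\<dots> \<le> 2 * real G" using G by (simp del: of_nat_mult)
  finally have "real i \<le> 2 * G / n" using n by (simp add: field_simps)
  then have "2 * sweep * i \<le> 2 * sweep * (2 * G / n)"
    using sweep_pos by (intro mult_left_mono) auto
  then show ?thesis using L by simp
qed

text \<open>Against a fixed \<open>\<sigma>\<close> the replies given by
  \<open>state_inv_step\<close> are chosen one after another; the play they generate is then turned
  into a strategy.\<close>

lemma exists_reply:
  fixes \<sigma> :: strategy1
  obtains \<tau> L G where
    "\<And>m. state_inv (fst (play (0, 0) \<sigma> \<tau> m)) (L m) (G m)" "\<And>m. L m + G m = m"
    "\<And>m. real (G m) \<le> (\<Sum>j=1..m. cost c (crossed_edge (0, 0) \<sigma> \<tau> j))"
proof -
  define P where "P m s \<longleftrightarrow> (case s of (u, h, L, G) \<Rightarrow> state_inv u L G \<and> L + G = m \<and> length h = m \<and>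
      (m = 0 \<longrightarrow> u = (0, 0) \<and> h = []))"
    for m and s :: "vertex \<times> edge list \<times> nat \<times> nat"
  define Q where "Q s s' r \<longleftrightarrow> (case s of (u, h, L, G) \<Rightarrow> case s' of (u', h', L', G') \<Rightarrow>
      u' = move u (\<sigma> h) r \<and> h' = h @ [{u, u'}] \<and> real G' \<le> real G + cost c {u, u'})"
    for s s' :: "vertex \<times> edge list \<times> nat \<times> nat" and r
  have "\<exists>s. \<forall>m. P m (s m) \<and> (\<exists>r. Q (s m) (s (Suc m)) r)"
  proof (rule dependent_nat_choice)
    show "\<exists>s. P 0 s"
      unfolding P_def using state_inv_origin by auto
    fix s m assume "P m s"
    obtain u h L G where s: "s = (u, h, L, G)" by (cases s)
    have I: "state_inv u L G" "L + G = m" "length h = m"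
      using \<open>P m s\<close> unfolding P_def s by auto
    obtain r where r: "state_inv (move u (\<sigma> h) r) (Suc L) G \<or>
        state_inv (move u (\<sigma> h) r) L (Suc G) \<and> c {u, move u (\<sigma> h) r}"
      using state_inv_step[OF I(1)] by blast
    then show "\<exists>s'. P (Suc m) s' \<and> (\<exists>r. Q s s' r)"
    proof
      assume "state_inv (move u (\<sigma> h) r) (Suc L) G"
      then have "P (Suc m) (move u (\<sigma> h) r, h @ [{u, move u (\<sigma> h) r}], Suc L, G)"
        "Q s (move u (\<sigma> h) r, h @ [{u, move u (\<sigma> h) r}], Suc L, G) r"
        using I unfolding P_def Q_def s by (auto simp: cost_def)
      then show ?thesis by blast
    next
      assume "state_inv (move u (\<sigma> h) r) L (Suc G) \<and> c {u, move u (\<sigma> h) r}"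
      then have "P (Suc m) (move u (\<sigma> h) r, h @ [{u, move u (\<sigma> h) r}], L, Suc G)"
        "Q s (move u (\<sigma> h) r, h @ [{u, move u (\<sigma> h) r}], L, Suc G) r"
        using I unfolding P_def Q_def s by (auto simp: cost_def)
      then show ?thesis by blast
    qed
  qed
  then obtain s r where P: "\<And>m. P m (s m)" and Q: "\<And>m. Q (s m) (s (Suc m)) (r m)"
    by metis
  \<comment> \<open>Only one history of each length occurs in this play, and \<open>\<sigma>\<close>
    fixes the first player's action there. So the reply may depend on the length alone and be the
    same for both actions.\<close>
  define \<tau> :: strategy2 where "\<tau> h = (r (length h), r (length h))" for h
  define L where "L m = fst (snd (snd (s m)))" for m
  define G where "G m = snd (snd (snd (s m)))" for m
  have P': "state_inv (fst (s m)) (L m) (G m)" "L m + G m = m" "length (fst (snd (s m))) = m"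
    "m = 0 \<longrightarrow> fst (s m) = (0, 0) \<and> fst (snd (s m)) = []" for m
    using P[of m] unfolding P_def L_def G_def case_prod_beta by blast+
  have Q': "fst (s (Suc m)) = move (fst (s m)) (\<sigma> (fst (snd (s m)))) (r m)"
    "fst (snd (s (Suc m))) = fst (snd (s m)) @ [{fst (s m), fst (s (Suc m))}]"
    "real (G (Suc m)) \<le> real (G m) + cost c {fst (s m), fst (s (Suc m))}" for m
    using Q[of m] unfolding Q_def G_def case_prod_beta by blast+
  have play: "play (0, 0) \<sigma> \<tau> m = (fst (s m), fst (snd (s m)))" for m
  proof (induction m)
    case 0
    then show ?case using P'(4)[of 0] by simp
  next
    case (Suc m)
    have "response \<tau> (fst (snd (s m))) x = r m" for x
      unfolding response_def \<tau>_def by (cases x) (simp_all add: P'(3))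
    then show ?case using Suc Q'(1,2)[of m] by (simp add: Let_def)
  qed
  have "real (G m) \<le> (\<Sum>j=1..m. cost c (crossed_edge (0, 0) \<sigma> \<tau> j))" for m
  proof (induction m)
    case 0
    then show ?case using P'(2)[of 0] by simp
  next
    case (Suc m)
    then show ?case using Q'(3)[of m] by (simp add: crossed_edge_def play)
  qed
  then show ?thesis
    using that[of \<tau> L G] P'(1,2) play by simp
qed

lemma total_cost_ge:
  assumes "mostly_good c"
  shows "\<exists>\<tau>. ereal (1 - 4 * sweep / n) \<le> total_cost c (0, 0) \<sigma> \<tau>"
proof -
  obtain \<tau> L G where *: "\<And>m. state_inv (fst (play (0, 0) \<sigma> \<tau> m)) (L m) (G m)" "\<And>m. L m + G m = m"
    "\<And>m. real (G m) \<le> (\<Sum>j=1..m. cost c (crossed_edge (0, 0) \<sigma> \<tau> j))"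
    using exists_reply[of \<sigma>] by blast
  define q where "q = 4 * sweep / n"
  have q: "q \<ge> 0" unfolding q_def using sweep_pos by simp
  define A where "A m = 1 / real m * (\<Sum>j=1..m. cost c (crossed_edge (0, 0) \<sigma> \<tau> j))" for m
  have "1 - q - 2 * sweep / m \<le> A m" if m: "m > 0" for m
  proof -
    have G: "real (G m) = real m - real (L m)" using *(2)[of m] by (metis add_diff_cancel_left' of_nat_add)
    have "real (L m) \<le> q * G m + 2 * sweep"
      unfolding q_def by (rule state_inv_loss_le[OF *(1) assms])
    also have "\<dots> \<le> q * m + 2 * sweep"
      using q G by (intro add_right_mono mult_left_mono) auto
    finally have "(1 - q) * m - 2 * sweep \<le> G m" using G by (simp add: algebra_simps)
    also have "\<dots> \<le> (\<Sum>j=1..m. cost c (crossed_edge (0, 0) \<sigma> \<tau> j))" by (rule *(3))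
    finally have "((1 - q) * m - 2 * sweep) / m \<le> (\<Sum>j=1..m. cost c (crossed_edge (0, 0) \<sigma> \<tau> j)) / m"
      using m by (intro divide_right_mono) auto
    then show ?thesis unfolding A_def using m by (simp add: diff_divide_distrib)
  qed
  then have "\<forall>\<^sub>F m in sequentially. ereal (1 - q - 2 * sweep / real m) \<le> ereal (A m)"
    by (intro eventually_sequentiallyI[of 1]) auto
  then have "limsup (\<lambda>m. ereal (1 - q - 2 * sweep / real m)) \<le> limsup (\<lambda>m. ereal (A m))"
    by (rule Limsup_mono)
  moreover have "(\<lambda>m. 1 - q - 2 * sweep / real m) \<longlonglongrightarrow> 1 - q - 0"
    by (intro tendsto_diff tendsto_const lim_const_over_n)
  then have "limsup (\<lambda>m. ereal (1 - q - 2 * sweep / real m)) = ereal (1 - q)"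
    by (intro lim_imp_Limsup) auto
  ultimately show ?thesis unfolding total_cost_def A_def q_def by auto
qed

lemma value_ge:
  assumes "mostly_good c" "has_value c (0, 0) w"
  shows "1 - 4 * sweep / n \<le> w"
proof -
  have "ereal (1 - 4 * sweep / n) \<le> (INF \<sigma>. SUP \<tau>. total_cost c (0, 0) \<sigma> \<tau>)"
  proof (rule INF_greatest)
    fix \<sigma>
    obtain \<tau> where "ereal (1 - 4 * sweep / n) \<le> total_cost c (0, 0) \<sigma> \<tau>"
      using total_cost_ge[OF assms(1)] by blast
    then show "ereal (1 - 4 * sweep / n) \<le> (SUP \<tau>. total_cost c (0, 0) \<sigma> \<tau>)"
      by (meson SUP_upper2 UNIV_I)
  qed
  then show ?thesis using assms(2) unfolding has_value_def by simp
qed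

end

text \<open>The value is almost surely the constant \<open>w\<close>, so a single
  \<open>mostly_good\<close> configuration with value \<open>w\<close> at the origin already bounds
  it.\<close>

lemma (in block_lattice) almost_sure_value_ge:
  assumes p: "p \<in> {0..1}" and likely: "cprob p (tube_crossed \<alpha> \<kappa> (5 * n)) \<ge> 1 - (1 / 72)\<^sup>2"
    and as_value: "is_almost_sure_value p w" and sweep_le: "width / (1 - \<alpha>) + 1 \<le> n"
  shows "1 - 4 * (width / (1 - \<alpha>) + 1) / n \<le> w"
proof -
  have "AE c in config_measure p. has_value c (0, 0) w"
    using as_value unfolding is_almost_sure_value_def by (auto simp: LL_def elim: eventually_mono)
  from mostly_good_exists[OF p likely this] obtain c where c: "has_value c (0, 0) w" "mostly_good c"
    by blast
  have "\<forall>i b. \<exists>f. good i b c \<longrightarrow> block_path c i b f"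
    using good_block_path by blast
  then obtain path where "\<forall>i b. good i b c \<longrightarrow> block_path c i b (path i b)"
    by metis
  then interpret good_blocks \<alpha> \<kappa> n c path
    using sweep_le by unfold_locales auto
  show ?thesis using value_ge[OF c(2,1)] unfolding sweep_def .
qed

section \<open>Continuity at the critical parameter\<close>

theorem theorem6p1:
  fixes v :: "real \<Rightarrow> real" and pc :: real
  assumes "is_critical_parameter pc"
    and "\<And>p. p \<in> {0..1} \<Longrightarrow> is_almost_sure_value p (v p)"
  shows "continuous (at pc within {0..1}) v"
proof -
  have pc: "0 < pc" "pc < 1"
    using assms(1) unfolding is_critical_parameter_def by auto
  interpret nonneg_drift pc
    using pc right_edge_mean_nonneg_critical[OF assms(1)] by unfold_locales
  define \<alpha> where "\<alpha> = speed"
  have \<alpha>: "0 \<le> \<alpha>" "\<alpha> < 1"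
    unfolding \<alpha>_def by (rule speed_nonneg speed_less_1)+
  have near: "(\<forall>\<^sub>F p in at pc within {0..1}. v p > 1 - \<epsilon>) \<and> v pc > 1 - \<epsilon>"
    if \<epsilon>: "0 < \<epsilon>" "\<epsilon> < 1" for \<epsilon> :: real
  proof -
    \<comment> \<open>Then \<open>2 * \<kappa> / (1 - \<alpha>)\<close> is
      \<open>\<epsilon> * n / 8\<close>, so the width of the tube contributes
      \<open>\<epsilon> / 2\<close> to the loss \<open>4 * sweep / n\<close>.\<close>
    define s where "s = \<epsilon> * (1 - \<alpha>) / 80"
    have s: "s > 0" unfolding s_def using \<epsilon> \<alpha> by simp
    have "\<forall>\<^sub>F N in sequentially. cprob pc (tube_crossed \<alpha> (s * real N) N) > 1 - (1 / 72)\<^sup>2"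
      unfolding \<alpha>_def by (rule tube_crossed_eventually[OF s]) simp
    then obtain N0 where N0: "\<And>N. N \<ge> N0 \<Longrightarrow> cprob pc (tube_crossed \<alpha> (s * real N) N) > 1 - (1 / 72)\<^sup>2"
      unfolding eventually_sequentially by blast
    define C where "C = 8 / (1 - \<alpha>) + 1"
    have C: "C > 0" unfolding C_def using \<alpha> by (simp add: add_pos_pos)
    \<comment> \<open>Large enough for the tube of height \<open>5 * n\<close> to be crossed, and
      for the constant \<open>C\<close>, which stems from the margins of the strip and from
      rounding, to contribute less than \<open>\<epsilon> / 2\<close>.\<close>
    define n where "n = max N0 (nat \<lceil>8 * C / \<epsilon>\<rceil>) + 1"
    have "8 * C / \<epsilon> < n" unfolding n_def by linarith
    then have n_large: "N0 \<le> 5 * n" "n > 0" "4 * C / n < \<epsilon> / 2"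
      using \<epsilon> unfolding n_def by (auto simp: field_simps)
    define \<kappa> where "\<kappa> = s * real (5 * n)"
    interpret block_lattice \<alpha> \<kappa> n
      using \<alpha> s n_large(2) unfolding \<kappa>_def by unfold_locales auto
    have sweep: "4 * (width / (1 - \<alpha>) + 1) / n < \<epsilon>"
    proof -
      have "\<kappa> = \<epsilon> * (1 - \<alpha>) / 16 * n" unfolding \<kappa>_def s_def by simp
      then have w: "width = (1 - \<alpha>) * (\<epsilon> * n / 8) + 8"
        unfolding width_def by (simp add: mult_ac)
      have "1 - \<alpha> \<noteq> 0" using \<alpha> by simp
      from nonzero_mult_div_cancel_left[OF this] have "width / (1 - \<alpha>) + 1 = \<epsilon> * n / 8 + C"
        unfolding C_def w add_divide_distrib by (simp only: add.assoc)
      then have "4 * (width / (1 - \<alpha>) + 1) / n = \<epsilon> / 2 + 4 * C / n"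
        using n_large(2) by (simp add: field_simps)
      then show ?thesis using n_large(3) by simp
    qed
    have sweep_le: "width / (1 - \<alpha>) + 1 \<le> n"
    proof -
      define x where "x = width / (1 - \<alpha>) + 1"
      have "4 * x < \<epsilon> * n"
        using sweep n_large(2) unfolding x_def[symmetric]
        by (simp only: pos_divide_less_eq of_nat_0_less_iff)
      moreover have "\<epsilon> * n \<le> 1 * real n"
        using \<epsilon> by (intro mult_right_mono) auto
      ultimately show ?thesis using n_large(2) unfolding x_def[symmetric] by linarith
    qed
    have large: "v p > 1 - \<epsilon>"
      if "p \<in> {0..1}" "cprob p (tube_crossed \<alpha> \<kappa> (5 * n)) > 1 - (1 / 72)\<^sup>2" for p
      using almost_sure_value_ge[OF that(1) less_imp_le[OF that(2)] assms(2)[OF that(1)] sweep_le] sweep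
      by linarith
    have crit: "cprob pc (tube_crossed \<alpha> \<kappa> (5 * n)) > 1 - (1 / 72)\<^sup>2"
      unfolding \<kappa>_def by (rule N0[OF n_large(1)])
    \<comment> \<open>Since \<open>n\<close> is now fixed, the crossing is a local event and stays
      likely on both sides of \<open>pc\<close>, also where there is no percolation.\<close>
    have "continuous_on {0..1} (\<lambda>p. cprob p (tube_crossed \<alpha> \<kappa> (5 * n)))"
      by (intro continuous_on_cprob local_on_mono[OF local_on_tube_crossed tube_edges_subset_EE])
    then have "((\<lambda>p. cprob p (tube_crossed \<alpha> \<kappa> (5 * n))) \<longlongrightarrow> cprob pc (tube_crossed \<alpha> \<kappa> (5 * n)))
        (at pc within {0..1})"
      using pc unfolding continuous_on_def by auto
    then have "\<forall>\<^sub>F p in at pc within {0..1}. cprob p (tube_crossed \<alpha> \<kappa> (5 * n)) > 1 - (1 / 72)\<^sup>2"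
      using crit by (rule order_tendstoD)
    moreover have "\<forall>\<^sub>F p in at pc within {0..1}. p \<in> {0..1}"
      by (auto simp: eventually_at_filter)
    ultimately have "\<forall>\<^sub>F p in at pc within {0..1}. v p > 1 - \<epsilon>"
      by eventually_elim (rule large)
    then show ?thesis using large[OF p01 crit] by blast
  qed
  have v_le: "v p \<le> 1" if "p \<in> {0..1}" for p
    using assms(2)[OF that] unfolding is_almost_sure_value_def by auto
  \<comment> \<open>Values never exceed 1, so letting \<open>\<epsilon>\<close> tend to 0 in
    \<open>near\<close> identifies the value at \<open>pc\<close> and the limit there.\<close>
  have "v pc = 1"
  proof (rule antisym[OF v_le[OF p01] field_le_epsilon])
    fix e :: real assume e: "e > 0"
    have "v pc > 1 - min e (1 / 2)" using near[of "min e (1 / 2)"] e by auto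
    then show "1 \<le> v pc + e" by linarith
  qed
  have "(v \<longlongrightarrow> v pc) (at pc within {0..1})"
  proof (rule tendstoI)
    fix e :: real assume e: "e > 0"
    have "\<forall>\<^sub>F p in at pc within {0..1}. v p > 1 - min e (1 / 2)"
      using near[of "min e (1 / 2)"] e by auto
    moreover have "\<forall>\<^sub>F p in at pc within {0..1}. p \<in> {0..1}"
      by (auto simp: eventually_at_filter)
    ultimately show "\<forall>\<^sub>F p in at pc within {0..1}. dist (v p) (v pc) < e"
    proof eventually_elim
      case (elim p)
      then show ?case using v_le[OF elim(2)] \<open>v pc = 1\<close> unfolding dist_real_def by linarith
    qed
  qed
  then show ?thesis unfolding continuous_within .
qed

end
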